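(* Let $K\subset\mathbb{R}^d$ be a compact set and $\alpha\in(0,1]$. The map $\Lambda\colon\operatorname{Lip}^\alpha(K)\to\mathbf{CH}^{0,\alpha}(K)$ is a Banach space isomorphism (a bounded linear bijection with bounded inverse).
   Context: $\operatorname{Lip}^\alpha(K)$ is the space of functions $f\colon K\to\mathbb{R}$ with $\operatorname{Lip}^\alpha(f)=\sup_{x\ne y}|f(x)-f(y)|/|x-y|^\alpha<\infty$, with norm $\max\{\|f\|_\infty,\operatorname{Lip}^\alpha(f)\}$. $\mathbf N_0(K)$ is the space of normal $0$-currents supported in $K$, i.e. finite signed Borel measures $T$ on $K$ regarded as functionals $T(g)=\int g\,dT$ on $C^\infty(\mathbb{R}^d)$. Here $\mathbf N(T)=\mathbf M(T)=\sup\{T(g):g\in C^\infty(\mathbb{R}^d),\|g\|_\infty\le1\}$ (total variation), and the flat norm is $\mathbf F(T)=\sup\{T(g):g\in C^\infty(\mathbb{R}^d),\ \max\{\|g\|_\infty,\|dg\|_\infty\}\le1\}$, where $\|dg\|_\infty$ is the supremum of the Euclidean norm of the gradient. An $\alpha$-fractional $0$-charge over $K$ is a linear functional $\omega\colon\mathbf N_0(K)\to\mathbb{R}$ for which there is $C\ge0$ with $|\omega(T)|\le C\,\mathbf N(T)^{1-\alpha}\mathbf F(T)^\alpha$ for all $T\in\mathbf N_0(K)$; $\mathbf{CH}^{0,\alpha}(K)$ is the Banach space of these, normed by the infimum of such $C$. For $f\in\operatorname{Lip}^\alpha(K)$, $\Lambda(f)(T)=\int_Kf\,dT$ for $T\in\mathbf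 N_0(K)$. *)

theory Defs
  imports "HOL-Analysis.Analysis"
begin

text \<open>
  All spaces below are spaces of real-valued functions on a subset \<open>D\<close> of a type, with the
  pointwise vector space operations. A function on \<open>D\<close> is represented by the total function
  that is \<open>0\<close> off \<open>D\<close>, so that equality of representatives is equality on \<open>D\<close>.
\<close>

subsection \<open>Hoelder functions\<close>

definition holder_quotients :: "'a::metric_space set \<Rightarrow> real \<Rightarrow> ('a \<Rightarrow> real) \<Rightarrow> real set" where
  "holder_quotients K \<alpha> f =
     {\<bar>f x - f y\<bar> / dist x y powr \<alpha> | x y. x \<in> K \<and> y \<in> K \<and> x \<noteq> y}"

definition Lip_space :: "'a::metric_space set \<Rightarrow> real \<Rightarrow> ('a \<Rightarrow> real) set" where
  "Lip_space K \<alpha> = {f. (\<forall>x. x \<notin> K \<longrightarrow> f x = 0) \<and> bdd_above (holder_quotients K \<alpha> f)}"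

text \<open>
  The \<open>insert 0\<close> makes the supremum of nonnegative numbers over an empty family equal to \<open>0\<close>
  (\<open>K\<close> empty, or \<open>K\<close> a singleton).
\<close>

definition Lip_seminorm :: "'a::metric_space set \<Rightarrow> real \<Rightarrow> ('a \<Rightarrow> real) \<Rightarrow> real" where
  "Lip_seminorm K \<alpha> f = Sup (insert 0 (holder_quotients K \<alpha> f))"

definition sup_norm_on :: "'a set \<Rightarrow> ('a \<Rightarrow> real) \<Rightarrow> real" where
  "sup_norm_on K f = Sup (insert 0 ((\<lambda>x. \<bar>f x\<bar>) ` K))"

definition Lip_norm :: "'a::metric_space set \<Rightarrow> real \<Rightarrow> ('a \<Rightarrow> real) \<Rightarrow> real" where
  "Lip_norm K \<alpha> f = max (sup_norm_on K f) (Lip_seminorm K \<alpha> f)"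

subsection \<open>Smooth functions\<close>

primrec times_cont_differentiable :: "nat \<Rightarrow> ('a::euclidean_space \<Rightarrow> real) \<Rightarrow> bool" where
  "times_cont_differentiable 0 g \<longleftrightarrow> continuous_on UNIV g"
| "times_cont_differentiable (Suc n) g \<longleftrightarrow>
     (\<forall>x. g differentiable (at x)) \<and>
     (\<forall>v. times_cont_differentiable n (\<lambda>x. frechet_derivative g (at x) v))"

definition smooth :: "('a::euclidean_space \<Rightarrow> real) \<Rightarrow> bool" where
  "smooth g \<longleftrightarrow> (\<forall>n. times_cont_differentiable n g)"

definition gradient :: "('a::euclidean_space \<Rightarrow> real) \<Rightarrow> 'a \<Rightarrow> 'a" where
  "gradient g x = (\<Sum>b\<in>Basis. frechet_derivative g (at x) b *\<^sub>R b)"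

subsection \<open>Finite signed Borel measures\<close>

definition finite_signed_borel_measure :: "('a::topological_space set \<Rightarrow> real) \<Rightarrow> bool" where
  "finite_signed_borel_measure T \<longleftrightarrow>
     T {} = 0 \<and>
     (\<forall>A::nat \<Rightarrow> 'a set. range A \<subseteq> sets borel \<longrightarrow> disjoint_family A \<longrightarrow>
        (\<lambda>n. T (A n)) sums T (\<Union>n. A n)) \<and>
     (\<forall>A. A \<notin> sets borel \<longrightarrow> T A = 0)"

text \<open>
  The positive part of the Jordan decomposition, \<open>T\<^sup>+(A) = sup {T(B) | B \<subseteq> A Borel}\<close>. The
  coercion \<open>ennreal\<close> sends negative numbers to \<open>0\<close>, which is harmless because of \<open>B = {}\<close>.
\<close>

definition pos_part :: "('a::topological_space set \<Rightarrow> real) \<Rightarrow> 'a measure" where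
  "pos_part T = measure_of UNIV (sets borel)
     (\<lambda>A. SUP B\<in>{B \<in> sets borel. B \<subseteq> A}. ennreal (T B))"

definition neg_part :: "('a::topological_space set \<Rightarrow> real) \<Rightarrow> 'a measure" where
  "neg_part T = pos_part (\<lambda>A. - T A)"

definition signed_integral ::
    "('a::topological_space set \<Rightarrow> real) \<Rightarrow> 'a set \<Rightarrow> ('a \<Rightarrow> real) \<Rightarrow> real" where
  "signed_integral T S f = (LINT x:S|pos_part T. f x) - (LINT x:S|neg_part T. f x)"

subsection \<open>Normal 0-currents\<close>

definition normal_0_currents :: "'a::topological_space set \<Rightarrow> ('a set \<Rightarrow> real) set" where
  "normal_0_currents K =
     {T. finite_signed_borel_measure T \<and> (\<forall>A\<in>sets borel. A \<inter> K = {} \<longrightarrow> T A = 0)}"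

text \<open>The boundary of a 0-current is zero, so the mass is also its normal norm.\<close>

definition mass :: "('a::euclidean_space set \<Rightarrow> real) \<Rightarrow> real" where
  "mass T = Sup {signed_integral T UNIV g | g. smooth g \<and> (\<forall>x. \<bar>g x\<bar> \<le> 1)}"

definition flat_norm :: "('a::euclidean_space set \<Rightarrow> real) \<Rightarrow> real" where
  "flat_norm T = Sup {signed_integral T UNIV g | g.
     smooth g \<and> (\<forall>x. \<bar>g x\<bar> \<le> 1) \<and> (\<forall>x. norm (gradient g x) \<le> 1)}"

subsection \<open>Fractional 0-charges\<close>

definition charge_bound ::
    "'a::euclidean_space set \<Rightarrow> real \<Rightarrow> (('a set \<Rightarrow> real) \<Rightarrow> real) \<Rightarrow> real \<Rightarrow> bool" where
  "charge_bound K \<alpha> \<omega> C \<longleftrightarrow> C \<ge> 0 \<and>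
     (\<forall>T\<in>normal_0_currents K. \<bar>\<omega> T\<bar> \<le> C * mass T powr (1 - \<alpha>) * flat_norm T powr \<alpha>)"

definition charge_space ::
    "'a::euclidean_space set \<Rightarrow> real \<Rightarrow> (('a set \<Rightarrow> real) \<Rightarrow> real) set" where
  "charge_space K \<alpha> = {\<omega>.
     (\<forall>S\<in>normal_0_currents K. \<forall>T\<in>normal_0_currents K. \<omega> (\<lambda>A. S A + T A) = \<omega> S + \<omega> T) \<and>
     (\<forall>c. \<forall>T\<in>normal_0_currents K. \<omega> (\<lambda>A. c * T A) = c * \<omega> T) \<and>
     (\<exists>C. charge_bound K \<alpha> \<omega> C) \<and>
     (\<forall>T. T \<notin> normal_0_currents K \<longrightarrow> \<omega> T = 0)}"

definition charge_norm ::
    "'a::euclidean_space set \<Rightarrow> real \<Rightarrow> (('a set \<Rightarrow> real) \<Rightarrow> real) \<Rightarrow> real" where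
  "charge_norm K \<alpha> \<omega> = Inf {C. charge_bound K \<alpha> \<omega> C}"

definition Lambda_map ::
    "'a::euclidean_space set \<Rightarrow> ('a \<Rightarrow> real) \<Rightarrow> ('a set \<Rightarrow> real) \<Rightarrow> real" where
  "Lambda_map K f = (\<lambda>T. if T \<in> normal_0_currents K then signed_integral T K f else 0)"

subsection \<open>Isomorphisms of normed function spaces\<close>

definition bounded_between ::
    "'x set \<Rightarrow> ('x \<Rightarrow> real) \<Rightarrow> ('y \<Rightarrow> real) \<Rightarrow> ('x \<Rightarrow> 'y) \<Rightarrow> bool" where
  "bounded_between X nX nY L \<longleftrightarrow> (\<exists>C. \<forall>f\<in>X. nY (L f) \<le> C * nX f)"

definition normed_space_iso ::
    "('i \<Rightarrow> real) set \<Rightarrow> (('i \<Rightarrow> real) \<Rightarrow> real) \<Rightarrow>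
     ('j \<Rightarrow> real) set \<Rightarrow> (('j \<Rightarrow> real) \<Rightarrow> real) \<Rightarrow> (('i \<Rightarrow> real) \<Rightarrow> 'j \<Rightarrow> real) \<Rightarrow> bool" where
  "normed_space_iso X nX Y nY L \<longleftrightarrow>
     (\<forall>f\<in>X. \<forall>g\<in>X. L (\<lambda>i. f i + g i) = (\<lambda>j. L f j + L g j)) \<and>
     (\<forall>c. \<forall>f\<in>X. L (\<lambda>i. c * f i) = (\<lambda>j. c * L f j)) \<and>
     bij_betw L X Y \<and>
     bounded_between X nX nY L \<and>
     bounded_between Y nY nX (inv_into X L)"

end

theory Submission
  imports Defs
begin

text \<open>
  A Hoelder function \<open>f\<close> on \<open>K\<close> is, for every scale \<open>\<epsilon> \<le> 1\<close>, within \<open>A \<epsilon>\<^sup>\<alpha>\<close> on \<open>K\<close> of a smooth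
  function bounded by about \<open>A\<close> with Lipschitz constant \<open>A \<epsilon>\<^sup>\<alpha>\<^sup>-\<^sup>1\<close>. Hence
  \<open>\<bar>\<integral> f dT\<bar> \<le> A (\<epsilon>\<^sup>\<alpha> M(T) + \<epsilon>\<^sup>\<alpha>\<^sup>-\<^sup>1 F(T))\<close>, and \<open>\<epsilon> = F(T) / M(T)\<close> makes \<open>\<Lambda>(f)\<close> a charge.
  Conversely, a charge \<open>\<omega>\<close> determines \<open>f(x) = \<omega>(\<delta>\<^sub>x)\<close>, which is Hoelder because
  \<open>M(\<delta>\<^sub>x - \<delta>\<^sub>y) \<le> 2\<close> and \<open>F(\<delta>\<^sub>x - \<delta>\<^sub>y) \<le> \<bar>x - y\<bar>\<close>. Finite combinations of Dirac masses are dense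
  in the flat norm with bounded mass, so a charge that vanishes on Dirac masses is \<open>0\<close>.
\<close>

subsection \<open>Jordan decomposition of signed measures\<close>

text \<open>\<open>mass\<close> and \<open>flat_norm\<close> see only smooth test functions, while
  \<Lambda>(f) pairs T with an f that is merely Hoelder and lives on K alone. Extension from K and
  smoothing are therefore done at once by an explicit formula in \<open>exp\<close> and
  \<open>ln\<close>, whose smoothness follows from closure rules. The error f - g is again only
  continuous on K, and its integral must be compared with \<open>mass T\<close>; this takes a
  second, cruder use of the same approximation, where the leftover is the total variation times an
  arbitrarily small factor. The other obstacle is that integrals are defined through the Jordan
  parts, which are not additive in T. Linearity in T and the push-forward formula come from a
  uniqueness principle: a bounded linear functional on bounded Borel functions is fixed by its
  values on indicators. Both operator bounds have constant 2: in one direction the two interpolation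
  terms are equal at the chosen \<epsilon>, which is admissible because F(T) \<le> M(T); in the
  other, the mass of a difference of Dirac masses contributes 2 powr (1 - \<alpha>) \<le> 2.\<close>

lemma signed_measure_Un:
  assumes "finite_signed_borel_measure T" "A \<in> sets borel" "B \<in> sets borel" "A \<inter> B = {}"
  shows "T (A \<union> B) = T A + T B"
proof -
  have "T {} = 0" using assms by (simp add: finite_signed_borel_measure_def)
  then have "(\<lambda>n. T (binaryset A B n)) sums (T A + T B)" by (rule binaryset_sums)
  moreover have "(\<lambda>n. T (binaryset A B n)) sums T (\<Union>n. binaryset A B n)"
  proof -
    have "range (binaryset A B) \<subseteq> sets borel" using assms(2,3) by (auto simp: binaryset_def)
    moreover have "disjoint_family (binaryset A B)"
      using assms(4) by (auto simp: disjoint_family_on_def binaryset_def)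
    ultimately show ?thesis using assms(1) by (simp add: finite_signed_borel_measure_def)
  qed
  ultimately show ?thesis using sums_unique2 by (fastforce simp: UN_binaryset_eq)
qed

lemma signed_measure_Diff:
  assumes "finite_signed_borel_measure T" "A \<in> sets borel" "B \<in> sets borel" "A \<subseteq> B"
  shows "T (B - A) = T B - T A"
proof -
  have "T (A \<union> (B - A)) = T A + T (B - A)" using assms by (intro signed_measure_Un) auto
  moreover have "A \<union> (B - A) = B" using assms(4) by auto
  ultimately show ?thesis by simp
qed

lemma signed_measure_split:
  assumes "finite_signed_borel_measure T" "A \<in> sets borel" "P \<in> sets borel"
  shows "T A = T (A \<inter> P) + T (A - P)"
proof -
  have "T ((A \<inter> P) \<union> (A - P)) = T (A \<inter> P) + T (A - P)"
    using assms by (intro signed_measure_Un) auto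
  moreover have "(A \<inter> P) \<union> (A - P) = A" by auto
  ultimately show ?thesis by simp
qed

lemma signed_measure_sums:
  assumes "finite_signed_borel_measure T" "\<And>n. A n \<in> sets borel" "disjoint_family A"
  shows "(\<lambda>n::nat. T (A n)) sums T (\<Union>n. A n)"
  using assms by (auto simp: finite_signed_borel_measure_def)

lemma signed_measure_empty: "finite_signed_borel_measure T \<Longrightarrow> T {} = 0"
  by (simp add: finite_signed_borel_measure_def)

text \<open>Greedy exhaustion: from D one removes again and again a piece that is about as negative
  as the remaining set allows. Removing nonpositive pieces cannot lower the measure, and since the
  removed values form a convergent series, no negative piece can be left over at the end.\<close>

lemma signed_measure_positive_subset:
  assumes T: "finite_signed_borel_measure T" and D: "D \<in> sets borel"
  shows "\<exists>A\<in>sets borel. A \<subseteq> D \<and> T D \<le> T A \<and> (\<forall>B\<in>sets borel. B \<subseteq> A \<longrightarrow> 0 \<le> T B)"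
proof -
  \<comment> \<open>A piece B realising half of the worst negative value in E. The cap at 1 is there
    because T has not yet been shown to be bounded below, so that the worst value might be
    infinite.\<close>
  have step: "\<exists>B\<in>sets borel. B \<subseteq> E \<and> T B \<le> 0 \<and>
      (\<forall>C\<in>sets borel. C \<subseteq> E \<longrightarrow> min 1 (- T C / 2) \<le> - T B)" for E
  proof (cases "\<exists>C\<in>sets borel. C \<subseteq> E \<and> 1 \<le> - T C")
    case True
    then obtain C where "C \<in> sets borel" "C \<subseteq> E" "1 \<le> - T C" by auto
    then show ?thesis by (intro bexI[of _ C]) auto
  next
    case False
    define S where "S = (\<lambda>C. - T C) ` {C \<in> sets borel. C \<subseteq> E}"
    have bdd: "bdd_above S" using False by (auto simp: S_def bdd_above_def intro!: exI[of _ 1])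
    have S0: "0 \<in> S"
      using signed_measure_empty[OF T] by (auto simp: S_def image_iff intro!: exI[of _ "{}"])
    have le: "- T C \<le> Sup S" if "C \<in> sets borel" "C \<subseteq> E" for C
      using that bdd by (intro cSup_upper) (auto simp: S_def)
    show ?thesis
    proof (cases "Sup S > 0")
      case True
      then obtain z where "z \<in> S" "Sup S / 2 < z"
        using S0 by (metis empty_iff half_gt_zero_iff less_cSupE field_sum_of_halves less_add_same_cancel1)
      then obtain B where B: "B \<in> sets borel" "B \<subseteq> E" "Sup S / 2 < - T B" by (auto simp: S_def)
      have "min 1 (- T C / 2) \<le> - T B" if "C \<in> sets borel" "C \<subseteq> E" for C
        using le[OF that] B(3) by linarith
      then show ?thesis using B True by (intro bexI[of _ B]) auto
    next
      case False
      then show ?thesis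
        using le signed_measure_empty[OF T] by (intro bexI[of _ "{}"]) (fastforce simp: min_def)+
    qed
  qed
  then obtain b where b: "\<And>E. b E \<in> sets borel" "\<And>E. b E \<subseteq> E" "\<And>E. T (b E) \<le> 0"
    "\<And>E C. C \<in> sets borel \<Longrightarrow> C \<subseteq> E \<Longrightarrow> min 1 (- T C / 2) \<le> - T (b E)"
    by metis
  define E where "E = rec_nat D (\<lambda>_ X. X - b X)"
  have E0: "E 0 = D" and ES: "E (Suc n) = E n - b (E n)" for n by (auto simp: E_def)
  have Esub: "E m \<subseteq> E n - b (E n)" if "n < m" for n m
    using that
  proof (induction m)
    case (Suc m)
    then show ?case by (cases "n = m") (auto simp: ES)
  qed simp
  have disj: "disjoint_family (\<lambda>n. b (E n))"
  proof -
    have "b (E n) \<inter> b (E m) = {}" if "n < m" for n m using Esub[OF that] b(2) by blast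
    then show ?thesis by (metis disjoint_family_on_def inf_commute nat_neq_iff)
  qed
  have sums: "(\<lambda>n. T (b (E n))) sums T (\<Union>n. b (E n))"
    using b(1) disj by (intro signed_measure_sums[OF T]) auto
  define A where "A = D - (\<Union>n. b (E n))"
  have ED: "E n \<subseteq> D" for n by (induction n) (auto simp: E0 ES)
  have UD: "(\<Union>n. b (E n)) \<subseteq> D" using b(2) ED by blast
  have A: "A \<in> sets borel" using D b(1) by (auto simp: A_def)
  have "T A = T D - T (\<Union>n. b (E n))" unfolding A_def
    using D b(1) UD by (intro signed_measure_Diff[OF T]) auto
  moreover have "T (\<Union>n. b (E n)) \<le> 0"
    using sums_le[OF _ sums sums_zero] b(3) by auto
  ultimately have TA: "T D \<le> T A" by simp
  have "0 \<le> T B" if B: "B \<in> sets borel" "B \<subseteq> A" for B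
  proof -
    \<comment> \<open>B survives every stage, so each removed piece was at least as negative as the
      capped half value of B. The removed values tend to 0, which forces that capped value to be at
      most 0.\<close>
    have AE: "A \<subseteq> E n" for n by (induction n) (auto simp: A_def E0 ES)
    have "(\<lambda>n. - T (b (E n))) \<longlonglongrightarrow> - 0"
      by (intro tendsto_minus summable_LIMSEQ_zero sums_summable[OF sums])
    moreover have "min 1 (- T B / 2) \<le> - T (b (E n))" for n
      using b(4)[OF B(1)] B(2) AE[of n] by auto
    ultimately have "min 1 (- T B / 2) \<le> - 0"
      by (intro LIMSEQ_le_const[where X = "\<lambda>n. - T (b (E n))"]) auto
    then show ?thesis by linarith
  qed
  then show ?thesis using A TA by (intro bexI[of _ A]) (auto simp: A_def)
qed

text \<open>P maximises T among the sets all of whose Borel subsets have nonnegative measure; this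
  class Q is closed under countable unions, so the supremum is attained. If some B outside P had
  positive measure, it would contain a member of Q of positive measure, and adjoining that to P
  would exceed the maximum.\<close>

lemma signed_measure_Hahn:
  assumes T: "finite_signed_borel_measure T"
  shows "\<exists>P\<in>sets borel. (\<forall>B\<in>sets borel. B \<subseteq> P \<longrightarrow> 0 \<le> T B) \<and>
           (\<forall>B\<in>sets borel. B \<inter> P = {} \<longrightarrow> T B \<le> 0)"
proof -
  define Q where "Q = {A \<in> sets borel. \<forall>B\<in>sets borel. B \<subseteq> A \<longrightarrow> 0 \<le> T B}"
  have UN: "(\<Union>n. A n) \<in> Q" if A: "\<And>n::nat. A n \<in> Q" for A
  proof -
    have Ab: "A n \<in> sets borel" for n using A by (auto simp: Q_def)
    have "0 \<le> T B" if B: "B \<in> sets borel" "B \<subseteq> (\<Union>n. A n)" for B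
    proof -
      have db: "disjointed A n \<in> sets borel" for n
        using Ab sets.range_disjointed_sets[of A borel] by auto
      have "(\<lambda>n. T (B \<inter> disjointed A n)) sums T (\<Union>n. B \<inter> disjointed A n)"
        using B db
        by (intro signed_measure_sums[OF T] disjoint_family_on_bisimulation[OF disjoint_family_disjointed[of A]])
          auto
      moreover have "(\<Union>n. B \<inter> disjointed A n) = B"
        using B(2) UN_disjointed_eq[of A] by auto
      moreover have "0 \<le> T (B \<inter> disjointed A n)" for n
      proof -
        have "B \<inter> disjointed A n \<in> sets borel" using B(1) db by auto
        then show ?thesis using A[of n] disjointed_subset[of A n] unfolding Q_def by blast
      qed
      ultimately show ?thesis using sums_le[OF _ sums_zero] by metis
    qed
    then show ?thesis using Ab by (auto simp: Q_def)
  qed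
  have mono: "T A \<le> T B" if "A \<in> Q" "B \<in> Q" "A \<subseteq> B" for A B
  proof -
    have "T (B - A) = T B - T A" using that by (intro signed_measure_Diff[OF T]) (auto simp: Q_def)
    moreover have "0 \<le> T (B - A)" using that by (auto simp: Q_def)
    ultimately show ?thesis by simp
  qed
  have empty: "{} \<in> Q" using signed_measure_empty[OF T] by (auto simp: Q_def)
  \<comment> \<open>T takes real values only: a union of members of Q with T-values beyond every n
    would itself lie in Q and have a value beyond every n.\<close>
  have bdd: "bdd_above (T ` Q)"
  proof (rule ccontr)
    assume "\<not> bdd_above (T ` Q)"
    then have "\<exists>A\<in>Q. real n < T A" for n by (force simp: bdd_above_def not_le)
    then obtain A where A: "\<And>n. A n \<in> Q" "\<And>n. real n < T (A n)" by metis
    have "real n < T (\<Union>n. A n)" for n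
      using A(2)[of n] mono[OF A(1) UN[of A, OF A(1)], of n] by fastforce
    then show False by (meson less_asym reals_Archimedean2)
  qed
  define s where "s = Sup (T ` Q)"
  have "\<exists>A\<in>Q. s - 1 / (real n + 1) < T A" for n
  proof -
    have "s - 1 / (real n + 1) < Sup (T ` Q)" by (simp add: s_def)
    then show ?thesis using empty less_cSupE[of _ "T ` Q"] by blast
  qed
  then obtain A where A: "\<And>n. A n \<in> Q" "\<And>n. s - 1 / (real n + 1) < T (A n)" by metis
  define P where "P = (\<Union>n. A n)"
  have PQ: "P \<in> Q" unfolding P_def using UN A(1) by blast
  have sP: "s \<le> T P"
  proof (rule LIMSEQ_le_const2)
    show "(\<lambda>n. s - 1 / (real n + 1)) \<longlonglongrightarrow> s"
      using tendsto_diff[OF tendsto_const[of s] LIMSEQ_inverse_real_of_nat]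
      by (simp add: inverse_eq_divide add.commute)
    have "s - 1 / (real n + 1) \<le> T P" for n
      using A(2)[of n] mono[OF A(1)[of n] PQ] by (fastforce simp: P_def)
    then show "\<exists>N. \<forall>n\<ge>N. s - 1 / (real n + 1) \<le> T P" by auto
  qed
  have "T B \<le> 0" if B: "B \<in> sets borel" "B \<inter> P = {}" for B
  proof (rule ccontr)
    assume "\<not> T B \<le> 0"
    obtain C where C: "C \<in> sets borel" "C \<subseteq> B" "T B \<le> T C" "\<forall>B\<in>sets borel. B \<subseteq> C \<longrightarrow> 0 \<le> T B"
      using signed_measure_positive_subset[OF T B(1)] by blast
    have CQ: "C \<in> Q" using C by (auto simp: Q_def)
    have "(\<Union>n::nat. if n = 0 then P else C) = P \<union> C"
      by (auto split: if_splits)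
    then have "P \<union> C \<in> Q" using UN[of "\<lambda>n. if n = 0 then P else C"] PQ CQ by auto
    then have "T (P \<union> C) \<le> s" unfolding s_def using bdd by (intro cSup_upper) auto
    moreover have "T (P \<union> C) = T P + T C"
      using PQ C B by (intro signed_measure_Un[OF T]) (auto simp: Q_def)
    ultimately show False using sP C(3) \<open>\<not> T B \<le> 0\<close> by linarith
  qed
  then show ?thesis using PQ by (intro bexI[of _ P]) (auto simp: Q_def)
qed

lemma signed_measure_uminus:
  "finite_signed_borel_measure T \<Longrightarrow> finite_signed_borel_measure (\<lambda>A. - T A)"
  by (auto simp: finite_signed_borel_measure_def intro!: sums_minus)

text \<open>Holds for every set function T, because \<open>measure_of\<close> keeps the given
  sigma-algebra even when the set function is not a measure.\<close>

lemma sets_pos_part [simp, measurable_cong]: "sets (pos_part T) = sets borel"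
  unfolding pos_part_def by (subst sets_measure_of) (auto simp: sets.sigma_sets_eq[of borel, simplified])

lemma sets_neg_part [simp, measurable_cong]: "sets (neg_part T) = sets borel"
  by (simp add: neg_part_def)

lemma space_pos_part [simp]: "space (pos_part T) = UNIV"
  using sets_eq_imp_space_eq[OF sets_pos_part] by simp

lemma space_neg_part [simp]: "space (neg_part T) = UNIV"
  by (simp add: neg_part_def)

text \<open>The supremum that defines \<open>pos_part\<close> is attained at A \<inter> P. This
  formula is what makes the set function countably additive, so that \<open>measure_of\<close>
  returns it instead of the zero measure.\<close>

lemma emeasure_pos_part_Hahn:
  assumes T: "finite_signed_borel_measure T" and P: "P \<in> sets borel"
    and pos: "\<And>B. B \<in> sets borel \<Longrightarrow> B \<subseteq> P \<Longrightarrow> 0 \<le> T B"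
    and neg: "\<And>B. B \<in> sets borel \<Longrightarrow> B \<inter> P = {} \<Longrightarrow> T B \<le> 0"
    and A: "A \<in> sets borel"
  shows "emeasure (pos_part T) A = ennreal (T (A \<inter> P))"
proof -
  define \<mu> where "\<mu> = (\<lambda>A. SUP B\<in>{B \<in> sets borel. B \<subseteq> A}. ennreal (T B))"
  have eq: "\<mu> A = ennreal (T (A \<inter> P))" if A: "A \<in> sets borel" for A
  proof -
    have "ennreal (T B) \<le> ennreal (T (A \<inter> P))" if B: "B \<in> sets borel" "B \<subseteq> A" for B
    proof -
      have "T B = T (B \<inter> P) + T (B - P)" using B P by (intro signed_measure_split[OF T])
      moreover have "T (B - P) \<le> 0" using B P by (intro neg) auto
      moreover have "T (A \<inter> P - B \<inter> P) = T (A \<inter> P) - T (B \<inter> P)"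
        using B P A by (intro signed_measure_Diff[OF T]) auto
      moreover have "0 \<le> T (A \<inter> P - B \<inter> P)" using B P A by (intro pos) auto
      ultimately show ?thesis by (intro ennreal_leI) linarith
    qed
    then show ?thesis unfolding \<mu>_def
      using A P by (intro antisym SUP_least SUP_upper2[of "A \<inter> P"]) auto
  qed
  have "countably_additive (sets borel) \<mu>"
  proof (rule countably_additiveI)
    fix F :: "nat \<Rightarrow> 'a set"
    assume F: "range F \<subseteq> sets borel" "disjoint_family F" "\<Union> (range F) \<in> sets borel"
    have Fb: "F n \<in> sets borel" for n using F(1) by auto
    have "(\<lambda>n. T (F n \<inter> P)) sums T (\<Union>n. F n \<inter> P)"
      using F P by (intro signed_measure_sums[OF T]) (auto simp: disjoint_family_on_def)
    moreover have "0 \<le> T (F n \<inter> P)" for n using P Fb by (intro pos) auto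
    ultimately have "(\<Sum>n. ennreal (T (F n \<inter> P))) = ennreal (T (\<Union>n. F n \<inter> P))"
      by (intro suminf_ennreal_eq)
    then show "(\<Sum>i. \<mu> (F i)) = \<mu> (\<Union> (range F))"
      using eq Fb F(3) by (simp add: Int_UN_distrib2)
  qed
  moreover have "positive (sets borel) \<mu>"
    using signed_measure_empty[OF T] by (simp add: positive_def eq)
  ultimately have "emeasure (measure_of UNIV (sets borel) \<mu>) A = \<mu> A"
    using A sets.sigma_algebra_axioms[of borel]
    by (intro emeasure_measure_of_sigma) auto
  then show ?thesis using eq[OF A] by (simp add: pos_part_def \<mu>_def)
qed

lemma signed_measure_Jordan:
  assumes T: "finite_signed_borel_measure T"
  obtains P where "P \<in> sets borel"
    "\<And>A. A \<in> sets borel \<Longrightarrow> emeasure (pos_part T) A = ennreal (T (A \<inter> P))"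
    "\<And>A. A \<in> sets borel \<Longrightarrow> emeasure (neg_part T) A = ennreal (- T (A - P))"
    "\<And>A. A \<in> sets borel \<Longrightarrow> 0 \<le> T (A \<inter> P)" "\<And>A. A \<in> sets borel \<Longrightarrow> 0 \<le> - T (A - P)"
proof -
  obtain P where P: "P \<in> sets borel"
    and *: "\<forall>B\<in>sets borel. B \<subseteq> P \<longrightarrow> 0 \<le> T B" "\<forall>B\<in>sets borel. B \<inter> P = {} \<longrightarrow> T B \<le> 0"
    using signed_measure_Hahn[OF T] by metis
  have pos: "0 \<le> T B" if "B \<in> sets borel" "B \<subseteq> P" for B using *(1) that by simp
  have neg: "T B \<le> 0" if "B \<in> sets borel" "B \<inter> P = {}" for B using *(2) that by simp
  have 1: "emeasure (neg_part T) A = ennreal (- T (A - P))" if A: "A \<in> sets borel" for A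
  proof -
    \<comment> \<open>The complement of P plays the role of P for -T.\<close>
    have "emeasure (neg_part T) A = ennreal (- T (A \<inter> (- P)))" unfolding neg_part_def
    proof (rule emeasure_pos_part_Hahn[OF signed_measure_uminus[OF T]])
      show "0 \<le> - T B" if "B \<in> sets borel" "B \<subseteq> - P" for B
        using neg[of B] that by auto
      show "- T B \<le> 0" if "B \<in> sets borel" "B \<inter> - P = {}" for B
        using pos[of B] that by auto
    qed (use P A in auto)
    then show ?thesis by (simp add: Diff_eq)
  qed
  have 2: "0 \<le> - T (A - P)" if A: "A \<in> sets borel" for A
    using neg[of "A - P"] A P by auto
  have 3: "0 \<le> T (A \<inter> P)" if A: "A \<in> sets borel" for A
    using pos[of "A \<inter> P"] A P by auto
  show ?thesis
    by (rule that[OF P emeasure_pos_part_Hahn[OF T P pos neg] 1 3 2])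
qed

lemma finite_measure_pos_part:
  assumes "finite_signed_borel_measure T" shows "finite_measure (pos_part T)"
proof -
  obtain P where "\<And>A. A \<in> sets borel \<Longrightarrow> emeasure (pos_part T) A = ennreal (T (A \<inter> P))"
    using signed_measure_Jordan[OF assms] by metis
  from this[of UNIV] show ?thesis by (intro finite_measureI) simp
qed

lemma finite_measure_neg_part:
  "finite_signed_borel_measure T \<Longrightarrow> finite_measure (neg_part T)"
  unfolding neg_part_def by (intro finite_measure_pos_part signed_measure_uminus)

lemma measure_pos_part_minus_neg_part:
  assumes T: "finite_signed_borel_measure T" and A: "A \<in> sets borel"
  shows "measure (pos_part T) A - measure (neg_part T) A = T A"
proof -
  obtain P where P: "P \<in> sets borel"
    "\<And>A. A \<in> sets borel \<Longrightarrow> emeasure (pos_part T) A = ennreal (T (A \<inter> P))"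
    "\<And>A. A \<in> sets borel \<Longrightarrow> emeasure (neg_part T) A = ennreal (- T (A - P))"
    "\<And>A. A \<in> sets borel \<Longrightarrow> 0 \<le> T (A \<inter> P)" "\<And>A. A \<in> sets borel \<Longrightarrow> 0 \<le> - T (A - P)"
    using signed_measure_Jordan[OF T] by metis
  show ?thesis using P(2-5)[OF A] signed_measure_split[OF T A P(1)] by (simp add: measure_def)
qed

subsection \<open>Smooth functions\<close>

lemma times_cont_differentiable_SucD:
  "times_cont_differentiable (Suc n) g \<Longrightarrow> times_cont_differentiable n g"
proof (induction n arbitrary: g)
  case 0
  then show ?case
    by (auto intro!: differentiable_imp_continuous_on simp: differentiable_on_def)
qed auto

text \<open>Replaces the description operator \<open>frechet_derivative\<close> by any derivative
  that has been computed explicitly.\<close>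

lemma times_cont_differentiable_SucI:
  assumes "\<And>x. (g has_derivative g' x) (at x)" "\<And>v. times_cont_differentiable n (\<lambda>x. g' x v)"
  shows "times_cont_differentiable (Suc n) g"
proof -
  have "frechet_derivative g (at x) = g' x" for x
    using frechet_derivative_at[OF assms(1)] by simp
  then show ?thesis using assms by (auto simp: differentiable_def)
qed

lemma times_cont_differentiable_SucE:
  assumes "times_cont_differentiable (Suc n) g"
  shows "(g has_derivative frechet_derivative g (at x)) (at x)"
    "times_cont_differentiable n (\<lambda>x. frechet_derivative g (at x) v)"
  using assms frechet_derivative_works by auto

lemma times_cont_differentiable_const: "times_cont_differentiable n (\<lambda>x. c)"
  by (induction n arbitrary: c) auto

lemma times_cont_differentiable_inner: "times_cont_differentiable n (\<lambda>x. x \<bullet> w)"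
proof (cases n)
  case (Suc m)
  have "((\<lambda>x. x \<bullet> w) has_derivative (\<lambda>v. v \<bullet> w)) (at x)" for x :: 'a
    by (auto intro!: derivative_eq_intros)
  then show ?thesis unfolding Suc
    by (rule times_cont_differentiable_SucI) (rule times_cont_differentiable_const)
qed (auto intro!: continuous_intros)

lemma times_cont_differentiable_add:
  "times_cont_differentiable n f \<Longrightarrow> times_cont_differentiable n g \<Longrightarrow>
    times_cont_differentiable n (\<lambda>x. f x + g x)"
proof (induction n arbitrary: f g)
  case (Suc n)
  show ?case
    by (rule times_cont_differentiable_SucI[OF has_derivative_add])
      (use times_cont_differentiable_SucE[OF Suc.prems(1)] times_cont_differentiable_SucE[OF Suc.prems(2)]
        Suc.IH in auto)
qed (auto intro!: continuous_intros)

lemma times_cont_differentiable_mult: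
  "times_cont_differentiable n f \<Longrightarrow> times_cont_differentiable n g \<Longrightarrow>
    times_cont_differentiable n (\<lambda>x. f x * g x)"
proof (induction n arbitrary: f g)
  case (Suc n)
  show ?case
    by (rule times_cont_differentiable_SucI[OF has_derivative_mult])
      (use times_cont_differentiable_SucE[OF Suc.prems(1)] times_cont_differentiable_SucE[OF Suc.prems(2)]
        Suc.IH times_cont_differentiable_SucD[OF Suc.prems(1)] times_cont_differentiable_SucD[OF Suc.prems(2)]
        in \<open>auto intro!: times_cont_differentiable_add\<close>)
qed (auto intro!: continuous_intros)

text \<open>The derivative contains exp (f x) again, now needed with one order less; the induction
  hypothesis supplies exactly that factor, and the product rule does the rest.\<close>

lemma times_cont_differentiable_exp:
  "times_cont_differentiable n f \<Longrightarrow> times_cont_differentiable n (\<lambda>x. exp (f x))"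
proof (induction n arbitrary: f)
  case (Suc n)
  have "((\<lambda>x. exp (f x)) has_derivative (\<lambda>v. exp (f x) * frechet_derivative f (at x) v)) (at x)" for x
    using times_cont_differentiable_SucE(1)[OF Suc.prems]
    by (auto intro!: derivative_eq_intros simp: mult.commute)
  then show ?case
    by (rule times_cont_differentiable_SucI)
      (intro times_cont_differentiable_mult Suc.IH times_cont_differentiable_SucD[OF Suc.prems]
        times_cont_differentiable_SucE(2)[OF Suc.prems])
qed (auto intro!: continuous_intros)

lemma times_cont_differentiable_ln:
  assumes "\<And>x. 0 < f x" "times_cont_differentiable n f"
  shows "times_cont_differentiable n (\<lambda>x. ln (f x))"
  using assms(2)
proof (induction n)
  case 0
  then show ?case using assms(1) by (auto intro!: continuous_intros simp: less_imp_neq[THEN not_sym])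
next
  case (Suc n)
  \<comment> \<open>The reciprocal of f x is written as exp (- ln (f x)). The induction hypothesis
    for the logarithm together with the rule for \<open>exp\<close> then covers it, and no separate
    rule for quotients enters.\<close>
  have D: "((\<lambda>x. ln (f x)) has_derivative
      (\<lambda>v. exp (- 1 * ln (f x)) * frechet_derivative f (at x) v)) (at x)" for x
  proof -
    have "((\<lambda>x. ln (f x)) has_derivative (\<lambda>v. frechet_derivative f (at x) v * inverse (f x))) (at x)"
      using times_cont_differentiable_SucE(1)[OF Suc.prems, of x] assms(1)[of x]
      by (auto intro!: derivative_eq_intros simp: divide_inverse mult.commute)
    moreover have "exp (- 1 * ln (f x)) = inverse (f x)" using assms(1)[of x] by (simp add: exp_minus)
    ultimately show ?thesis by (simp add: mult.commute)
  qed
  then show ?case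
    by (rule times_cont_differentiable_SucI)
      (intro times_cont_differentiable_mult times_cont_differentiable_exp times_cont_differentiable_const
        Suc.IH times_cont_differentiable_SucD[OF Suc.prems] times_cont_differentiable_SucE(2)[OF Suc.prems])
qed

lemma smooth_const: "smooth (\<lambda>x. c)"
  by (simp add: smooth_def times_cont_differentiable_const)

lemma smooth_inner: "smooth (\<lambda>x. x \<bullet> w)"
  by (simp add: smooth_def times_cont_differentiable_inner)

lemma smooth_add: "smooth f \<Longrightarrow> smooth g \<Longrightarrow> smooth (\<lambda>x. f x + g x)"
  by (simp add: smooth_def times_cont_differentiable_add)

lemma smooth_mult: "smooth f \<Longrightarrow> smooth g \<Longrightarrow> smooth (\<lambda>x. f x * g x)"
  by (simp add: smooth_def times_cont_differentiable_mult)

lemma smooth_exp: "smooth f \<Longrightarrow> smooth (\<lambda>x. exp (f x))"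
  by (simp add: smooth_def times_cont_differentiable_exp)

lemma smooth_ln: "(\<And>x. 0 < f x) \<Longrightarrow> smooth f \<Longrightarrow> smooth (\<lambda>x. ln (f x))"
  by (simp add: smooth_def times_cont_differentiable_ln)

lemma smooth_sum: "(\<And>i. i \<in> I \<Longrightarrow> smooth (f i)) \<Longrightarrow> smooth (\<lambda>x. \<Sum>i\<in>I. f i x)"
  by (induction I rule: infinite_finite_induct) (auto intro: smooth_const smooth_add)

lemma smooth_imp_has_derivative:
  "smooth g \<Longrightarrow> (g has_derivative frechet_derivative g (at x)) (at x)"
  unfolding smooth_def using times_cont_differentiable_SucE(1) by blast

lemma smooth_imp_continuous_on: "smooth g \<Longrightarrow> continuous_on A g"
  using continuous_on_subset[of UNIV g A] by (auto simp: smooth_def dest: spec[of _ 0])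

lemma frechet_derivative_eq_inner_gradient:
  assumes "smooth g"
  shows "frechet_derivative g (at x) v = gradient g x \<bullet> v"
proof -
  interpret linear "frechet_derivative g (at x)"
    using smooth_imp_has_derivative[OF assms] has_derivative_linear by blast
  have "frechet_derivative g (at x) v = frechet_derivative g (at x) (\<Sum>b\<in>Basis. (v \<bullet> b) *\<^sub>R b)"
    by (simp add: euclidean_representation)
  also have "\<dots> = (\<Sum>b\<in>Basis. (v \<bullet> b) * frechet_derivative g (at x) b)"
    by (simp add: sum scale)
  also have "\<dots> = gradient g x \<bullet> v"
    unfolding gradient_def inner_sum_left inner_scaleR_left by (simp add: inner_commute mult.commute)
  finally show ?thesis .
qed

text \<open>Lets the flat norm be handled by differences g x - g y alone. One direction is the mean
  value inequality, the other a directional derivative.\<close>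

lemma norm_gradient_le_iff_Lipschitz:
  assumes g: "smooth g" and b: "0 \<le> b"
  shows "(\<forall>x. norm (gradient g x) \<le> b) \<longleftrightarrow> (\<forall>x y. \<bar>g x - g y\<bar> \<le> b * dist x y)"
proof
  assume le: "\<forall>x. norm (gradient g x) \<le> b"
  have "norm (g x - g y) \<le> b * norm (x - y)" for x y
  proof (rule differentiable_bound[of UNIV g "\<lambda>x. frechet_derivative g (at x)"])
    show "onorm (frechet_derivative g (at x)) \<le> b" for x
    proof (rule onorm_bound[OF b])
      show "norm (frechet_derivative g (at x) v) \<le> b * norm v" for v
        using Cauchy_Schwarz_ineq2[of "gradient g x" v] le
          mult_right_mono[of "norm (gradient g x)" b "norm v"]
        by (auto simp: frechet_derivative_eq_inner_gradient[OF g] intro: order_trans)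
    qed
  qed (use smooth_imp_has_derivative[OF g] in auto)
  then show "\<forall>x y. \<bar>g x - g y\<bar> \<le> b * dist x y" by (simp add: dist_norm)
next
  assume le: "\<forall>x y. \<bar>g x - g y\<bar> \<le> b * dist x y"
  show "\<forall>x. norm (gradient g x) \<le> b"
  proof
    fix x
    \<comment> \<open>Differentiating in the direction of the gradient itself gives its squared norm
      as derivative, while the Lipschitz bound limits the difference quotients to b * norm
      v.\<close>
    define v where "v = gradient g x"
    have "((\<lambda>t. g (x + t *\<^sub>R v)) has_derivative (\<lambda>t. frechet_derivative g (at x) (t *\<^sub>R v))) (at 0)"
    proof -
      have "((\<lambda>t. x + t *\<^sub>R v) has_derivative (\<lambda>t. t *\<^sub>R v)) (at 0)"
        by (auto intro!: derivative_eq_intros)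
      moreover have "(g has_derivative frechet_derivative g (at x)) (at (x + 0 *\<^sub>R v))"
        using smooth_imp_has_derivative[OF g, of x] by simp
      ultimately show ?thesis by (rule has_derivative_compose)
    qed
    then have "((\<lambda>t. g (x + t *\<^sub>R v)) has_real_derivative (v \<bullet> v)) (at 0)"
      by (simp add: has_field_derivative_def frechet_derivative_eq_inner_gradient[OF g] v_def
          mult.commute[of _ "gradient g x \<bullet> gradient g x"])
    then have lim: "((\<lambda>t. (g (x + t *\<^sub>R v) - g x) / t) \<longlongrightarrow> v \<bullet> v) (at 0)"
      by (simp add: has_field_derivative_iff)
    have "v \<bullet> v \<le> b * norm v"
    proof (rule tendsto_upperbound[OF lim])
      have "(g (x + t *\<^sub>R v) - g x) / t \<le> b * norm v" if "t \<noteq> 0" for t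
      proof -
        have "\<bar>g (x + t *\<^sub>R v) - g x\<bar> \<le> b * norm v * \<bar>t\<bar>"
          using le[rule_format, of "x + t *\<^sub>R v" x] by (simp add: dist_norm mult_ac)
        then have "\<bar>(g (x + t *\<^sub>R v) - g x) / t\<bar> \<le> b * norm v"
          using that by (simp add: abs_divide field_simps)
        then show ?thesis by linarith
      qed
      then show "\<forall>\<^sub>F t in at 0. (g (x + t *\<^sub>R v) - g x) / t \<le> b * norm v"
        by (auto simp: eventually_at intro!: exI[of _ 1])
    qed simp
    then have "norm v * norm v \<le> b * norm v" by (simp add: dot_square_norm power2_eq_square)
    then show "norm (gradient g x) \<le> b"
      using b by (cases "v = 0") (auto simp: v_def[symmetric])
  qed
qed

section \<open>Smooth approximation from a compact set with a prescribed Lipschitz constant\<close>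

lemma compact_finite_net:
  fixes K :: "'a::metric_space set"
  assumes "compact K" "0 < \<eta>"
  shows "\<exists>F. finite F \<and> F \<subseteq> K \<and> K \<subseteq> (\<Union>y\<in>F. ball y \<eta>)"
proof -
  have "K \<subseteq> (\<Union>y\<in>K. ball y \<eta>)" using assms(2) by force
  then obtain F where "F \<subseteq> K" "finite F" "K \<subseteq> (\<Union>y\<in>F. ball y \<eta>)"
    by (rule compactE_image[OF assms(1), rotated]) auto
  then show ?thesis by blast
qed

text \<open>The norm in the product space is the square root of norm (x - y)^2 + \<delta>^2. This
  quantity stays positive, so its root can be written as exp (1 / 2 * ln _). Using the product norm
  also makes the 1-Lipschitz bound for the cone an instance of the triangle inequality.\<close>

lemma smooth_sqrt_norm_diff:
  assumes "0 < (\<delta>::real)"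
  shows "smooth (\<lambda>x::'a::euclidean_space. norm (x - y, \<delta>))"
proof -
  define w where "w = (\<lambda>x::'a. (\<Sum>b\<in>Basis. (x \<bullet> b + - (y \<bullet> b)) * (x \<bullet> b + - (y \<bullet> b))) + \<delta> * \<delta>)"
  have w: "w x = (norm (x - y))\<^sup>2 + \<delta>\<^sup>2" for x
    unfolding w_def power2_norm_eq_inner euclidean_inner[of "x - y" "x - y"]
    by (simp add: inner_diff_left power2_eq_square)
  have pos: "0 < w x" for x
    using assms by (simp add: w add_nonneg_pos)
  have "smooth w" unfolding w_def
    by (intro smooth_add smooth_sum smooth_mult smooth_const smooth_inner)
  then have "smooth (\<lambda>x. exp (1 / 2 * ln (w x)))"
    by (intro smooth_exp smooth_mult smooth_const smooth_ln pos)
  moreover have "exp (1 / 2 * ln (w x)) = norm (x - y, \<delta>)" for x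
    using pos[of x] assms by (simp add: norm_Pair w powr_half_sqrt[symmetric] powr_def)
  ultimately show ?thesis by simp
qed

text \<open>
  The approximant is a soft minimum of the constant \<open>M\<close> and of smoothed cones of slope \<open>b\<close>
  with vertices over a finite net of \<open>K\<close>. The soft minimum is monotone and commutes with adding
  constants, so it inherits the Lipschitz constant \<open>b\<close> of the cones.
\<close>

lemma smooth_Lipschitz_approximation:
  fixes K :: "'a::euclidean_space set"
  assumes K: "compact K" and b: "0 \<le> b" and \<kappa>: "0 < \<kappa>" and M: "0 \<le> M"
    and uM: "\<And>x. x \<in> K \<Longrightarrow> \<bar>u x\<bar> \<le> M"
    and a: "0 \<le> a" and u: "\<And>x y. x \<in> K \<Longrightarrow> y \<in> K \<Longrightarrow> u x - u y \<le> a + b * dist x y"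
  obtains g where "smooth g" "\<And>x. \<bar>g x\<bar> \<le> M + \<kappa>" "\<And>x y. \<bar>g x - g y\<bar> \<le> b * dist x y"
    "\<And>x. x \<in> K \<Longrightarrow> \<bar>g x - u x\<bar> \<le> a + \<kappa>"
proof -
  \<comment> \<open>The factor 4 leaves room for b * \<eta>, the step to a nearby net point, and b *
    (\<eta> + \<delta>), the height of the smoothed cone there. Dividing by b + 1 covers b =
    0.\<close>
  define \<eta> where "\<eta> = \<kappa> / (4 * (b + 1))"
  have \<eta>: "0 < \<eta>" using b \<kappa> by (simp add: \<eta>_def)
  obtain F where F: "finite F" "F \<subseteq> K" "K \<subseteq> (\<Union>y\<in>F. ball y \<eta>)"
    using compact_finite_net[OF K \<eta>] by blast
  \<comment> \<open>N counts the terms of the soft minimum: one cone per net point and the constant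
    M. The soft minimum drops below the true one by at most \<delta> * ln N, and \<delta> \<le>
    \<kappa> / N with ln N \<le> N keeps this loss within \<kappa>.\<close>
  define N where "N = real (card F) + 1"
  have N: "1 \<le> N" by (simp add: N_def)
  define \<delta> where "\<delta> = min \<eta> (\<kappa> / N)"
  have \<delta>: "0 < \<delta>" using \<eta> \<kappa> N by (simp add: \<delta>_def)
  have \<delta>N: "\<delta> * ln N \<le> \<kappa>"
  proof -
    have "\<delta> * ln N \<le> \<kappa> / N * N"
      using \<kappa> N \<delta> ln_bound[of N] by (intro mult_mono) (auto simp: \<delta>_def)
    then show ?thesis using N by simp
  qed
  have b\<eta>: "b * \<eta> + b * (\<eta> + \<delta>) \<le> \<kappa>"
  proof -
    have "b * \<eta> + b * (\<eta> + \<delta>) \<le> (b + 1) * (4 * \<eta>)"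
    proof -
      have "b * \<delta> \<le> b * \<eta>" using b by (intro mult_left_mono) (auto simp: \<delta>_def)
      moreover have "0 \<le> b * \<eta>" using b \<eta> by simp
      ultimately show ?thesis using \<eta> by (simp add: algebra_simps)
    qed
    also have "\<dots> = \<kappa>" using b by (simp add: \<eta>_def divide_eq_eq)
    finally show ?thesis .
  qed
  define q where "q = (\<lambda>y x. u y + b * norm (x - y, \<delta>))"
  define Z where "Z = (\<lambda>x. exp (- M / \<delta>) + (\<Sum>y\<in>F. exp (- 1 / \<delta> * q y x)))"
  define g where "g = (\<lambda>x. - \<delta> * ln (Z x))"
  have Zpos: "0 < Z x" for x
    unfolding Z_def by (intro add_pos_nonneg sum_nonneg) auto
  have "smooth Z" unfolding Z_def q_def
    by (intro smooth_add smooth_mult smooth_const smooth_exp smooth_sum smooth_sqrt_norm_diff \<delta>)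
  then have smooth: "smooth g" unfolding g_def
    by (intro smooth_mult smooth_const smooth_ln Zpos)
  \<comment> \<open>Since g = - \<delta> * ln Z, upper bounds for g are lower bounds for the sum of
    exponentials Z; a single summand already gives \<open>gM\<close> and \<open>gq\<close>.\<close>
  have le_if: "g x \<le> t" if "exp (- t / \<delta>) \<le> Z x" for x t
  proof -
    have "- t / \<delta> \<le> ln (Z x)" using that Zpos[of x] by (simp add: ln_ge_iff)
    then show ?thesis using \<delta> by (simp add: g_def field_simps)
  qed
  have gM: "g x \<le> M" for x
    by (rule le_if) (auto simp: Z_def intro!: sum_nonneg)
  have gq: "g x \<le> q y x" if "y \<in> F" for x y
  proof (rule le_if)
    have "exp (- 1 / \<delta> * q y x) \<le> (\<Sum>y\<in>F. exp (- 1 / \<delta> * q y x))"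
      using that F(1) by (intro member_le_sum) auto
    also have "\<dots> \<le> Z x" by (simp add: Z_def)
    finally show "exp (- q y x / \<delta>) \<le> Z x" by simp
  qed
  \<comment> \<open>If m lies below all N terms, every exponential is at most exp (- m / \<delta>).
    Hence Z \<le> N * exp (- m / \<delta>), which costs \<delta> * ln N.\<close>
  have ge: "m - \<kappa> \<le> g x" if "m \<le> M" "\<And>y. y \<in> F \<Longrightarrow> m \<le> q y x" for m x
  proof -
    have "Z x \<le> exp (- m / \<delta>) + (\<Sum>y\<in>F. exp (- m / \<delta>))" unfolding Z_def
      using that \<delta> by (intro add_mono sum_mono) (auto simp: divide_right_mono)
    also have "\<dots> = N * exp (- m / \<delta>)" by (simp add: N_def algebra_simps)
    finally have "ln (Z x) \<le> ln (N * exp (- m / \<delta>))" using Zpos N by (subst ln_le_cancel_iff) auto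
    also have "\<dots> = ln N - m / \<delta>" using N by (simp add: ln_mult)
    finally have "\<delta> * ln (Z x) \<le> \<delta> * (ln N - m / \<delta>)" using \<delta> by simp
    also have "\<dots> \<le> \<kappa> - m" using \<delta> \<delta>N by (simp add: algebra_simps)
    finally show ?thesis by (simp add: g_def)
  qed
  have lip: "g x \<le> g x' + b * dist x x'" for x x'
  proof (rule le_if)
    define t where "t = b * dist x x'"
    have t: "0 \<le> t" using b by (simp add: t_def)
    have q: "q y x \<le> q y x' + t" for y
    proof -
      have "norm (x - y, \<delta>) \<le> norm (x' - y, \<delta>) + norm ((x - y, \<delta>) - (x' - y, \<delta>))"
        by (metis add.commute diff_add_cancel norm_triangle_ineq)
      also have "norm ((x - y, \<delta>) - (x' - y, \<delta>)) = dist x x'"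
        by (simp add: norm_Pair dist_norm)
      finally have "b * norm (x - y, \<delta>) \<le> b * (norm (x' - y, \<delta>) + dist x x')"
        using b by (rule mult_left_mono)
      then show ?thesis by (simp add: q_def t_def distrib_left)
    qed
    \<comment> \<open>Adding t to g x' multiplies Z x' by exp (- t / \<delta>), that is, raises
      every term of the soft minimum by t. The raised terms at x' dominate the terms at x, the
      constant term because M \<le> M + t.\<close>
    have "exp (- (g x' + t) / \<delta>) = exp (- t / \<delta>) * Z x'"
    proof -
      have "- (g x' + t) / \<delta> = - t / \<delta> + ln (Z x')" using \<delta> by (simp add: g_def field_simps)
      then show ?thesis using Zpos[of x'] by (simp only: exp_add exp_ln)
    qed
    also have "\<dots> = exp (- (M + t) / \<delta>) + (\<Sum>y\<in>F. exp (- 1 / \<delta> * (q y x' + t)))"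
    proof -
      have "exp (- t / \<delta>) * exp (- M / \<delta>) = exp (- (M + t) / \<delta>)"
        "exp (- t / \<delta>) * exp (- 1 / \<delta> * q y x') = exp (- 1 / \<delta> * (q y x' + t))" for y
        by (simp_all add: mult_exp_exp add_divide_distrib diff_divide_distrib)
      then show ?thesis by (simp only: Z_def distrib_left[of "exp _"] sum_distrib_left)
    qed
    also have "\<dots> \<le> Z x" unfolding Z_def
      using \<delta> t q by (intro add_mono sum_mono) (auto simp: divide_right_mono diff_divide_distrib)
    finally show "exp (- (g x' + b * dist x x') / \<delta>) \<le> Z x" by (simp add: t_def)
  qed
  have q_ge: "u y + b * dist x y \<le> q y x" for x y
  proof -
    have "dist x y \<le> norm (x - y, \<delta>)" by (simp add: norm_Pair dist_norm real_le_rsqrt)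
    then show ?thesis using b by (simp add: q_def mult_left_mono)
  qed
  show ?thesis
  proof
    show "smooth g" by (rule smooth)
    show "\<bar>g x - g y\<bar> \<le> b * dist x y" for x y
      using lip[of x y] lip[of y x] by (simp add: dist_commute abs_le_iff)
    show "\<bar>g x\<bar> \<le> M + \<kappa>" for x
    proof -
      have "- M - \<kappa> \<le> g x"
      proof (rule ge)
        show "- M \<le> q y x" if "y \<in> F" for y
        proof -
          have "0 \<le> b * dist x y" using b by simp
          then show ?thesis using uM[of y] q_ge[of y x] that F(2) by force
        qed
      qed (use M in simp)
      then show ?thesis using gM[of x] \<kappa> by linarith
    qed
    show "\<bar>g x - u x\<bar> \<le> a + \<kappa>" if x: "x \<in> K" for x
    proof -
      obtain y where y: "y \<in> F" "dist y x < \<eta>" using F(3) x by auto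
      have "norm (x - y, \<delta>) \<le> norm (x - y) + \<delta>" using norm_Pair_le[of "x - y" \<delta>] \<delta> by simp
      then have "norm (x - y, \<delta>) \<le> \<eta> + \<delta>" using y(2) by (simp add: dist_norm norm_minus_commute)
      then have "q y x \<le> u y + b * (\<eta> + \<delta>)" using b by (simp add: q_def mult_left_mono)
      moreover have "u y - u x \<le> a + b * \<eta>"
        using u[of y x] y F(2) x mult_left_mono[of "dist y x" \<eta> b] b by force
      ultimately have 1: "g x \<le> u x + a + \<kappa>" using gq[OF y(1), of x] b\<eta> by linarith
      have "(u x - a) - \<kappa> \<le> g x"
      proof (rule ge)
        show "u x - a \<le> M" using uM[OF x] a by linarith
        show "u x - a \<le> q y x" if "y \<in> F" for y
          using u[of x y] x that F(2) q_ge[of y x] by force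
      qed
      then show ?thesis using 1 by linarith
    qed
  qed
qed

subsection \<open>Integration against signed measures\<close>

text \<open>One class of integrands that is integrable against both Jordan parts of every finite
  signed measure, so that integrability conditions do not depend on the measure at hand.\<close>

definition bounded_borel :: "('a::topological_space \<Rightarrow> real) set" where
  "bounded_borel = {f \<in> borel_measurable borel. \<exists>c. \<forall>x. \<bar>f x\<bar> \<le> c}"

lemma bounded_borelI: "f \<in> borel_measurable borel \<Longrightarrow> (\<And>x. \<bar>f x\<bar> \<le> c) \<Longrightarrow> f \<in> bounded_borel"
  by (auto simp: bounded_borel_def)

lemma bounded_borelD: "f \<in> bounded_borel \<Longrightarrow> f \<in> borel_measurable borel"
  by (simp add: bounded_borel_def)

lemma bounded_borelE:
  assumes "f \<in> bounded_borel" obtains c where "0 \<le> c" "\<And>x. \<bar>f x\<bar> \<le> c"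
proof -
  obtain c where c: "\<And>x. \<bar>f x\<bar> \<le> c" using assms by (auto simp: bounded_borel_def)
  moreover have "0 \<le> c" using order_trans[OF abs_ge_zero c] .
  ultimately show ?thesis using that by blast
qed

lemma bounded_borel_add:
  assumes "f \<in> bounded_borel" "g \<in> bounded_borel" shows "(\<lambda>x. f x + g x) \<in> bounded_borel"
proof -
  obtain c d where "\<And>x. \<bar>f x\<bar> \<le> c" "\<And>x. \<bar>g x\<bar> \<le> d" using assms by (metis bounded_borelE)
  then show ?thesis using assms[THEN bounded_borelD]
    by (intro bounded_borelI[of _ "c + d"]) (auto intro: order_trans[OF abs_triangle_ineq] add_mono)
qed

lemma bounded_borel_mult:
  assumes "f \<in> bounded_borel" "g \<in> bounded_borel" shows "(\<lambda>x. f x * g x) \<in> bounded_borel"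
proof -
  obtain c d where "\<And>x. \<bar>f x\<bar> \<le> c" "\<And>x. \<bar>g x\<bar> \<le> d" "0 \<le> c" using assms by (metis bounded_borelE)
  then show ?thesis using assms[THEN bounded_borelD]
    by (intro bounded_borelI[of _ "c * d"]) (auto simp: abs_mult intro!: mult_mono)
qed

lemma bounded_borel_const: "(\<lambda>x. c) \<in> bounded_borel"
  by (rule bounded_borelI[of _ "\<bar>c\<bar>"]) auto

lemma bounded_borel_cmult: "f \<in> bounded_borel \<Longrightarrow> (\<lambda>x. c * f x) \<in> bounded_borel"
  by (intro bounded_borel_mult bounded_borel_const)

lemma bounded_borel_diff:
  "f \<in> bounded_borel \<Longrightarrow> g \<in> bounded_borel \<Longrightarrow> (\<lambda>x. f x - g x) \<in> bounded_borel"
  using bounded_borel_add[OF _ bounded_borel_cmult[of g "-1"], of f] by simp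

lemma bounded_borel_indicator: "A \<in> sets borel \<Longrightarrow> indicator A \<in> bounded_borel"
  by (rule bounded_borelI[of _ 1]) (auto simp: indicator_def)

lemma bounded_borel_compose:
  assumes "f \<in> bounded_borel" "r \<in> borel_measurable borel"
  shows "(\<lambda>x. f (r x)) \<in> bounded_borel"
  using assms measurable_compose[of r borel borel f borel] by (auto simp: bounded_borel_def)

text \<open>D vanishes on finite combinations of indicators, and rounding n * f down to integers
  approximates f by such combinations uniformly within 1 / n. The bound on D turns this into \<bar>D
  f\<bar> \<le> V / n for all n.\<close>

lemma bounded_functional_eq_0:
  assumes add: "\<And>f g. f \<in> bounded_borel \<Longrightarrow> g \<in> bounded_borel \<Longrightarrow> D (\<lambda>x. f x + g x) = D f + D g"
    and cmult: "\<And>c f. f \<in> bounded_borel \<Longrightarrow> D (\<lambda>x. c * f x) = c * D f"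
    and ind: "\<And>A. A \<in> sets borel \<Longrightarrow> D (indicator A) = (0::real)"
    and bound: "\<And>f c. f \<in> bounded_borel \<Longrightarrow> (\<And>x. \<bar>f x\<bar> \<le> c) \<Longrightarrow> \<bar>D f\<bar> \<le> c * V"
    and f: "f \<in> bounded_borel"
  shows "D f = 0"
proof -
  obtain c where c: "\<And>x. \<bar>f x\<bar> \<le> c" "0 \<le> c" using f by (metis bounded_borelE)
  have [measurable]: "f \<in> borel_measurable borel" using f by (rule bounded_borelD)
  have "\<bar>D f\<bar> \<le> 1 / n * V" if n: "0 < n" for n :: real
  proof -
    define N where "N = \<lceil>n * c\<rceil> + 1"
    define A where "A = (\<lambda>k::int. {x. \<lfloor>n * f x\<rfloor> = k})"
    have A: "A k \<in> sets borel" for k unfolding A_def by measurable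
    define s where "s = (\<lambda>x. of_int \<lfloor>n * f x\<rfloor> / n)"
    have s_eq: "s = (\<lambda>x. \<Sum>k\<in>{-N..N}. of_int k / n * indicator (A k) x)"
    proof
      fix x
      have "\<bar>n * f x\<bar> \<le> n * c" using c(1)[of x] n by (simp add: abs_mult)
      then have "\<lfloor>n * f x\<rfloor> \<in> {-N..N}" unfolding N_def by (simp add: abs_le_iff) linarith
      moreover have "(\<Sum>k\<in>{-N..N}. of_int k / n * indicator (A k) x) =
          (\<Sum>k\<in>{-N..N}. if \<lfloor>n * f x\<rfloor> = k then of_int k / n else 0)"
        by (intro sum.cong) (auto simp: A_def indicator_def)
      ultimately show "s x = (\<Sum>k\<in>{-N..N}. of_int k / n * indicator (A k) x)"
        by (simp add: s_def)
    qed
    have sum: "(\<lambda>x. \<Sum>k\<in>S. of_int k / n * indicator (A k) x) \<in> bounded_borel \<and>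
        D (\<lambda>x. \<Sum>k\<in>S. of_int k / n * indicator (A k) x) = 0" if "finite S" for S :: "int set"
      using that
    proof (induction S)
      case empty
      show ?case using cmult[OF bounded_borel_const, of 0 0] bounded_borel_const[of 0] by simp
    next
      case (insert k S)
      have 1: "(\<lambda>x. of_int k / n * indicator (A k) x) \<in> bounded_borel"
        by (intro bounded_borel_cmult bounded_borel_indicator A)
      have "D (\<lambda>x. of_int k / n * indicator (A k) x) = 0"
        by (simp only: cmult[OF bounded_borel_indicator[OF A]] ind[OF A] mult_zero_right)
      then show ?case using insert add[OF 1] bounded_borel_add[OF 1] by simp
    qed
    have s: "s \<in> bounded_borel" "D s = 0" using sum[of "{-N..N}"] by (auto simp: s_eq)
    have "D (\<lambda>x. s x + (f x - s x)) = D s + D (\<lambda>x. f x - s x)"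
      by (intro add s bounded_borel_diff f)
    then have "D f = D (\<lambda>x. f x - s x)" using s by simp
    also have "\<bar>\<dots>\<bar> \<le> 1 / n * V"
    proof (rule bound[OF bounded_borel_diff[OF f s(1)]])
      fix x
      have "f x - s x = (n * f x - of_int \<lfloor>n * f x\<rfloor>) / n" using n by (simp add: s_def field_simps)
      moreover have "\<bar>n * f x - of_int \<lfloor>n * f x\<rfloor>\<bar> \<le> 1" by linarith
      ultimately show "\<bar>f x - s x\<bar> \<le> 1 / n" using n by (simp add: abs_divide divide_right_mono)
    qed
    finally show ?thesis .
  qed
  then have "\<bar>D f\<bar> \<le> inverse (real (Suc n)) * V" for n by (simp add: inverse_eq_divide)
  moreover have "(\<lambda>n. inverse (real (Suc n)) * V) \<longlonglongrightarrow> 0 * V"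
    by (intro tendsto_mult LIMSEQ_inverse_real_of_nat tendsto_const)
  ultimately have "\<bar>D f\<bar> \<le> 0 * V"
    by (intro LIMSEQ_le_const) auto
  then show ?thesis by simp
qed

lemma integrable_pos_part:
  assumes "finite_signed_borel_measure T" "f \<in> bounded_borel"
  shows "integrable (pos_part T) f"
proof -
  interpret finite_measure "pos_part T" using assms(1) by (rule finite_measure_pos_part)
  obtain c where "\<And>x. \<bar>f x\<bar> \<le> c" using assms(2) by (metis bounded_borelE)
  then show ?thesis using bounded_borelD[OF assms(2)]
    by (intro integrable_const_bound[of _ c]) auto
qed

lemma integrable_neg_part:
  "finite_signed_borel_measure T \<Longrightarrow> f \<in> bounded_borel \<Longrightarrow> integrable (neg_part T) f"
  unfolding neg_part_def by (intro integrable_pos_part signed_measure_uminus)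

lemma signed_integral_UNIV_eq:
  "signed_integral T UNIV f = (LINT x|pos_part T. f x) - (LINT x|neg_part T. f x)"
  by (simp add: signed_integral_def set_lebesgue_integral_def)

lemma signed_integral_eq_UNIV:
  "signed_integral T K f = signed_integral T UNIV (\<lambda>x. indicator K x * f x)"
  by (simp add: signed_integral_def set_lebesgue_integral_def)

lemma signed_integral_add:
  "finite_signed_borel_measure T \<Longrightarrow> f \<in> bounded_borel \<Longrightarrow> g \<in> bounded_borel \<Longrightarrow>
    signed_integral T UNIV (\<lambda>x. f x + g x) = signed_integral T UNIV f + signed_integral T UNIV g"
  by (simp add: signed_integral_UNIV_eq integrable_pos_part integrable_neg_part)

lemma signed_integral_diff:
  "finite_signed_borel_measure T \<Longrightarrow> f \<in> bounded_borel \<Longrightarrow> g \<in> bounded_borel \<Longrightarrow>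
    signed_integral T UNIV (\<lambda>x. f x - g x) = signed_integral T UNIV f - signed_integral T UNIV g"
  by (simp add: signed_integral_UNIV_eq integrable_pos_part integrable_neg_part)

lemma signed_integral_cmult:
  "signed_integral T UNIV (\<lambda>x. c * f x) = c * signed_integral T UNIV f"
  by (simp add: signed_integral_UNIV_eq right_diff_distrib)

lemma signed_integral_indicator:
  assumes "finite_signed_borel_measure T" "A \<in> sets borel"
  shows "signed_integral T UNIV (indicator A) = T A"
  using measure_pos_part_minus_neg_part[OF assms] by (simp add: signed_integral_UNIV_eq)

text \<open>An a priori bound valid for all bounded Borel integrands, whereas \<open>mass\<close> by
  definition controls smooth ones. In the later estimates it appears next to a factor that can be
  made arbitrarily small.\<close>

definition total_variation :: "('a::topological_space set \<Rightarrow> real) \<Rightarrow> real" where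
  "total_variation T = measure (pos_part T) UNIV + measure (neg_part T) UNIV"

lemma total_variation_nonneg: "0 \<le> total_variation T"
  by (simp add: total_variation_def)

lemma abs_signed_integral_le:
  assumes T: "finite_signed_borel_measure T" and f: "f \<in> bounded_borel" and c: "\<And>x. \<bar>f x\<bar> \<le> c"
  shows "\<bar>signed_integral T UNIV f\<bar> \<le> c * total_variation T"
proof -
  have *: "\<bar>LINT x|M. f x\<bar> \<le> c * measure M UNIV"
    if "finite_measure M" "integrable M f" "space M = UNIV" for M :: "'a measure"
  proof -
    interpret finite_measure M by fact
    have "\<bar>LINT x|M. f x\<bar> \<le> (LINT x|M. \<bar>f x\<bar>)" by (rule integral_abs_bound)
    also have "\<dots> \<le> (LINT x|M. c)" using that c by (intro integral_mono) auto
    also have "\<dots> = c * measure M UNIV" using that by simp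
    finally show ?thesis .
  qed
  show ?thesis
    using *[OF finite_measure_pos_part[OF T] integrable_pos_part[OF T f]]
      *[OF finite_measure_neg_part[OF T] integrable_neg_part[OF T f]]
    by (simp add: signed_integral_UNIV_eq total_variation_def distrib_left)
qed

text \<open>The Jordan parts of a sum are not the sums of the Jordan parts, so identities between
  integrals against different measures cannot be read off the definition. It is enough that a
  candidate J is linear, bounded and correct on indicators.\<close>

lemma signed_integral_unique:
  assumes T: "finite_signed_borel_measure T"
    and add: "\<And>f g. f \<in> bounded_borel \<Longrightarrow> g \<in> bounded_borel \<Longrightarrow> J (\<lambda>x. f x + g x) = J f + J g"
    and cmult: "\<And>c f. f \<in> bounded_borel \<Longrightarrow> J (\<lambda>x. c * f x) = c * J f"
    and ind: "\<And>A. A \<in> sets borel \<Longrightarrow> J (indicator A) = T A"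
    and bound: "\<And>f c. f \<in> bounded_borel \<Longrightarrow> (\<And>x. \<bar>f x\<bar> \<le> c) \<Longrightarrow> \<bar>J f\<bar> \<le> c * V"
    and f: "f \<in> bounded_borel"
  shows "signed_integral T UNIV f = J f"
proof -
  have "J f - signed_integral T UNIV f = 0"
  proof (rule bounded_functional_eq_0[OF _ _ _ _ f,
        of "\<lambda>f. J f - signed_integral T UNIV f" "V + total_variation T"])
    show "\<bar>J f - signed_integral T UNIV f\<bar> \<le> c * (V + total_variation T)"
      if "f \<in> bounded_borel" "\<And>x. \<bar>f x\<bar> \<le> c" for f c
      using bound[OF that] abs_signed_integral_le[OF T that] by (simp add: distrib_left)
  qed (simp_all add: add cmult ind signed_integral_add[OF T] signed_integral_cmult
      signed_integral_indicator[OF T] right_diff_distrib)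
  then show ?thesis by simp
qed

lemma signed_measure_add:
  "finite_signed_borel_measure S \<Longrightarrow> finite_signed_borel_measure T \<Longrightarrow>
    finite_signed_borel_measure (\<lambda>A. S A + T A)"
  by (auto simp: finite_signed_borel_measure_def intro!: sums_add)

lemma signed_measure_cmult:
  "finite_signed_borel_measure T \<Longrightarrow> finite_signed_borel_measure (\<lambda>A. c * T A)"
  by (auto simp: finite_signed_borel_measure_def intro!: sums_mult)

lemma signed_integral_measure_add:
  assumes S: "finite_signed_borel_measure S" and T: "finite_signed_borel_measure T"
    and f: "f \<in> bounded_borel"
  shows "signed_integral (\<lambda>A. S A + T A) UNIV f = signed_integral S UNIV f + signed_integral T UNIV f"
proof (rule signed_integral_unique[OF signed_measure_add[OF S T] _ _ _ _ f])
  show "\<bar>signed_integral S UNIV f + signed_integral T UNIV f\<bar> \<le> c * (total_variation S + total_variation T)"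
    if "f \<in> bounded_borel" "\<And>x. \<bar>f x\<bar> \<le> c" for f c
    using abs_signed_integral_le[OF S that] abs_signed_integral_le[OF T that] by (simp add: distrib_left)
qed (simp_all add: signed_integral_add S T signed_integral_cmult signed_integral_indicator distrib_left)

lemma signed_integral_measure_cmult:
  assumes T: "finite_signed_borel_measure T" and f: "f \<in> bounded_borel"
  shows "signed_integral (\<lambda>A. c * T A) UNIV f = c * signed_integral T UNIV f"
proof (rule signed_integral_unique[OF signed_measure_cmult[OF T] _ _ _ _ f])
  show "\<bar>c * signed_integral T UNIV f\<bar> \<le> k * (\<bar>c\<bar> * total_variation T)"
    if "f \<in> bounded_borel" "\<And>x. \<bar>f x\<bar> \<le> k" for f k
    using mult_left_mono[OF abs_signed_integral_le[OF T that], of "\<bar>c\<bar>"] by (simp add: abs_mult mult_ac)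
qed (simp_all add: signed_integral_add T signed_integral_cmult signed_integral_indicator distrib_left)

section \<open>Push-forwards, Dirac masses and concentration on K\<close>

text \<open>The case distinction keeps the convention that signed measures are 0 on non-Borel sets;
  the preimage of a non-Borel set may well be Borel.\<close>

definition signed_pushforward ::
    "('a::topological_space \<Rightarrow> 'b::topological_space) \<Rightarrow> ('a set \<Rightarrow> real) \<Rightarrow> 'b set \<Rightarrow> real" where
  "signed_pushforward r T = (\<lambda>A. if A \<in> sets borel then T (r -` A) else 0)"

lemma borel_vimage: "r \<in> borel_measurable borel \<Longrightarrow> A \<in> sets borel \<Longrightarrow> r -` A \<in> sets borel"
  using measurable_sets[of r borel borel A] by simp

lemma signed_measure_pushforward:
  assumes T: "finite_signed_borel_measure T" and r: "r \<in> borel_measurable borel"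
  shows "finite_signed_borel_measure (signed_pushforward r T)"
  unfolding finite_signed_borel_measure_def
proof (intro conjI allI impI)
  fix A :: "nat \<Rightarrow> 'b set" assume A: "range A \<subseteq> sets borel" "disjoint_family A"
  have "(\<lambda>n. T (r -` A n)) sums T (\<Union>n. r -` A n)"
    using A borel_vimage[OF r]
    by (intro signed_measure_sums[OF T] disjoint_family_on_vimageI) auto
  moreover have "(\<Union>n. A n) \<in> sets borel" "\<And>n. A n \<in> sets borel" using A by auto
  ultimately show "(\<lambda>n. signed_pushforward r T (A n)) sums signed_pushforward r T (\<Union>n. A n)"
    by (simp add: signed_pushforward_def vimage_UN)
qed (auto simp: signed_pushforward_def signed_measure_empty[OF T])

lemma signed_integral_pushforward:
  assumes T: "finite_signed_borel_measure T" and r: "r \<in> borel_measurable borel"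
    and f: "f \<in> bounded_borel"
  shows "signed_integral (signed_pushforward r T) UNIV f = signed_integral T UNIV (\<lambda>x. f (r x))"
proof (rule signed_integral_unique[OF signed_measure_pushforward[OF T r] _ _ _ _ f])
  show "signed_integral T UNIV (\<lambda>x. indicator A (r x)) = signed_pushforward r T A"
    if "A \<in> sets borel" for A
  proof -
    have "(\<lambda>x. indicat_real A (r x)) = indicator (r -` A)" by (auto simp: indicator_def)
    then show ?thesis using that signed_integral_indicator[OF T borel_vimage[OF r that]]
      by (simp add: signed_pushforward_def)
  qed
  show "\<bar>signed_integral T UNIV (\<lambda>x. f (r x))\<bar> \<le> c * total_variation T"
    if "f \<in> bounded_borel" "\<And>x. \<bar>f x\<bar> \<le> c" for f c
    using that(2) by (rule abs_signed_integral_le[OF T bounded_borel_compose[OF that(1) r]])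
qed (simp_all add: signed_integral_add T signed_integral_cmult bounded_borel_compose r)

definition dirac :: "'a::topological_space \<Rightarrow> 'a set \<Rightarrow> real" where
  "dirac x = (\<lambda>A. if A \<in> sets borel \<and> x \<in> A then 1 else 0)"

lemma signed_measure_dirac: "finite_signed_borel_measure (dirac x)"
  unfolding finite_signed_borel_measure_def
proof (intro conjI allI impI)
  fix A :: "nat \<Rightarrow> 'a set" assume A: "range A \<subseteq> sets borel" "disjoint_family A"
  have UN: "(\<Union>n. A n) \<in> sets borel" using A by auto
  show "(\<lambda>n. dirac x (A n)) sums dirac x (\<Union>n. A n)"
  proof (cases "\<exists>m. x \<in> A m")
    case True
    then obtain m where m: "x \<in> A m" ..
    have "dirac x (A n) = (if n = m then 1 else 0)" for n
      using A m by (auto simp: dirac_def disjoint_family_on_def)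
    moreover have "dirac x (\<Union>n. A n) = 1" using m UN by (auto simp: dirac_def)
    ultimately show ?thesis using sums_single[of m "\<lambda>_. 1::real"] by simp
  qed (simp add: dirac_def)
qed (auto simp: dirac_def)

lemma signed_integral_dirac: "f \<in> bounded_borel \<Longrightarrow> signed_integral (dirac x) UNIV f = f x"
  by (rule signed_integral_unique[OF signed_measure_dirac, where V = 1])
    (auto simp: dirac_def indicator_def)

text \<open>Both sides agree on indicators because T (A - K) = 0. It allows an integrand to be
  changed off K, in particular a globally defined smooth function to be compared with a function on
  K.\<close>

lemma signed_integral_concentrated:
  assumes T: "T \<in> normal_0_currents K" and K: "K \<in> sets borel" and f: "f \<in> bounded_borel"
  shows "signed_integral T UNIV f = signed_integral T UNIV (\<lambda>x. indicator K x * f x)"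
proof -
  have fT: "finite_signed_borel_measure T" using T by (simp add: normal_0_currents_def)
  show ?thesis
  proof (rule signed_integral_unique[OF fT _ _ _ _ f])
    have [simp]: "(\<lambda>x. indicator K x * f x) \<in> bounded_borel" if "f \<in> bounded_borel" for f :: "'a \<Rightarrow> real"
      using that K by (intro bounded_borel_mult bounded_borel_indicator)
    show "signed_integral T UNIV (\<lambda>x. indicator K x * (f x + g x)) =
        signed_integral T UNIV (\<lambda>x. indicator K x * f x) + signed_integral T UNIV (\<lambda>x. indicator K x * g x)"
      if "f \<in> bounded_borel" "g \<in> bounded_borel" for f g
      using that by (simp add: distrib_left signed_integral_add[OF fT])
    show "signed_integral T UNIV (\<lambda>x. indicator K x * (c * f x)) =
        c * signed_integral T UNIV (\<lambda>x. indicator K x * f x)" for c f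
      using signed_integral_cmult[of T c "\<lambda>x. indicator K x * f x"] by (simp add: mult_ac)
    show "signed_integral T UNIV (\<lambda>x. indicator K x * indicator A x) = T A" if A: "A \<in> sets borel" for A
    proof -
      have "(\<lambda>x. indicator K x * indicator A x :: real) = indicator (A \<inter> K)"
        by (auto simp: indicator_def)
      moreover have "T (A - K) = 0" using T A K by (auto simp: normal_0_currents_def)
      ultimately show ?thesis
        using signed_integral_indicator[OF fT, of "A \<inter> K"] signed_measure_split[OF fT A K] A K by simp
    qed
    show "\<bar>signed_integral T UNIV (\<lambda>x. indicator K x * f x)\<bar> \<le> c * total_variation T"
      if "f \<in> bounded_borel" "\<And>x. \<bar>f x\<bar> \<le> c" for f c
    proof (rule abs_signed_integral_le[OF fT])
      show "\<bar>indicator K x * f x\<bar> \<le> c" for x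
        using that(2)[of x] order_trans[OF abs_ge_zero that(2)] by (auto simp: indicator_def)
    qed (use that in simp)
  qed
qed

subsection \<open>Mass and flat norm\<close>

lemma smooth_bounded_borel: "smooth g \<Longrightarrow> (\<And>x. \<bar>g x\<bar> \<le> c) \<Longrightarrow> g \<in> bounded_borel"
  by (intro bounded_borelI borel_measurable_continuous_onI smooth_imp_continuous_on)

lemma abs_signed_integral_smooth_le_mass:
  assumes T: "finite_signed_borel_measure T" and g: "smooth g" "\<And>x. \<bar>g x\<bar> \<le> c" and c: "0 < c"
  shows "\<bar>signed_integral T UNIV g\<bar> \<le> c * mass T"
proof -
  have le: "signed_integral T UNIV h \<le> mass T" if "smooth h" "\<forall>x. \<bar>h x\<bar> \<le> 1" for h
    unfolding mass_def
  proof (rule cSup_upper)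
    show "bdd_above {signed_integral T UNIV g |g. smooth g \<and> (\<forall>x. \<bar>g x\<bar> \<le> 1)}"
    proof (rule bdd_aboveI)
      fix s assume "s \<in> {signed_integral T UNIV g |g. smooth g \<and> (\<forall>x. \<bar>g x\<bar> \<le> 1)}"
      then obtain g where "s = signed_integral T UNIV g" "smooth g" "\<forall>x. \<bar>g x\<bar> \<le> 1" by auto
      then show "s \<le> 1 * total_variation T"
        using abs_signed_integral_le[OF T smooth_bounded_borel, of g 1 1] by auto
    qed
  qed (use that in auto)
  \<comment> \<open>Both signs of the normalised function are admissible test functions, which
    bounds the absolute value. The division requires c > 0, and callers secure this by adding some
    \<kappa>.\<close>
  have "d * signed_integral T UNIV g \<le> mass T" if "d = 1 / c \<or> d = - 1 / c" for d
  proof -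
    have "\<bar>d * g x\<bar> \<le> 1" for x using that g(2)[of x] c by (auto simp: abs_mult)
    then show ?thesis using le[of "\<lambda>x. d * g x"] g(1) by (simp add: signed_integral_cmult smooth_mult smooth_const)
  qed
  from this[of "1 / c"] this[of "- 1 / c"] show ?thesis using c by (simp add: abs_le_iff field_simps)
qed

lemma mass_le:
  assumes "\<And>g. smooth g \<Longrightarrow> (\<And>x. \<bar>g x\<bar> \<le> 1) \<Longrightarrow> signed_integral T UNIV g \<le> c"
  shows "mass T \<le> c"
  unfolding mass_def using assms smooth_const[of 0] by (intro cSup_least) (auto intro!: exI[of _ "\<lambda>x. 0"])

lemma mass_nonneg:
  assumes "finite_signed_borel_measure T" shows "0 \<le> mass T"
proof -
  have "\<bar>signed_integral T UNIV (\<lambda>x. 0)\<bar> \<le> 1 * mass T"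
    using assms by (intro abs_signed_integral_smooth_le_mass smooth_const) auto
  then show ?thesis by linarith
qed

lemma abs_signed_integral_smooth_le_flat_norm:
  assumes T: "finite_signed_borel_measure T"
    and g: "smooth g" "\<And>x. \<bar>g x\<bar> \<le> c" "\<And>x y. \<bar>g x - g y\<bar> \<le> c * dist x y" and c: "0 < c"
  shows "\<bar>signed_integral T UNIV g\<bar> \<le> c * flat_norm T"
proof -
  have le: "signed_integral T UNIV h \<le> flat_norm T"
    if "smooth h" "\<forall>x. \<bar>h x\<bar> \<le> 1" "\<forall>x. norm (gradient h x) \<le> 1" for h
    unfolding flat_norm_def
  proof (rule cSup_upper)
    show "bdd_above {signed_integral T UNIV g |g. smooth g \<and> (\<forall>x. \<bar>g x\<bar> \<le> 1) \<and> (\<forall>x. norm (gradient g x) \<le> 1)}"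
    proof (rule bdd_aboveI)
      fix s assume "s \<in> {signed_integral T UNIV g |g. smooth g \<and> (\<forall>x. \<bar>g x\<bar> \<le> 1) \<and> (\<forall>x. norm (gradient g x) \<le> 1)}"
      then obtain g where "s = signed_integral T UNIV g" "smooth g" "\<forall>x. \<bar>g x\<bar> \<le> 1" by auto
      then show "s \<le> 1 * total_variation T"
        using abs_signed_integral_le[OF T smooth_bounded_borel, of g 1 1] by auto
    qed
  qed (use that in auto)
  have "d * signed_integral T UNIV g \<le> flat_norm T" if "d = 1 / c \<or> d = - 1 / c" for d
  proof -
    have s: "smooth (\<lambda>x. d * g x)" using g(1) by (simp add: smooth_mult smooth_const)
    have "\<bar>d * g x\<bar> \<le> 1" for x using that g(2)[of x] c by (auto simp: abs_mult)
    moreover have "\<bar>d * g x - d * g y\<bar> \<le> 1 * dist x y" for x y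
    proof -
      have "\<bar>d * g x - d * g y\<bar> = \<bar>g x - g y\<bar> / c"
        using that c by (auto simp: abs_mult simp flip: right_diff_distrib)
      then show ?thesis using g(3)[of x y] c by (simp add: pos_divide_le_eq mult.commute)
    qed
    ultimately show ?thesis
      using le[OF s] norm_gradient_le_iff_Lipschitz[OF s, of 1] by (simp add: signed_integral_cmult)
  qed
  from this[of "1 / c"] this[of "- 1 / c"] show ?thesis using c by (simp add: abs_le_iff field_simps)
qed

lemma flat_norm_le:
  assumes "\<And>g. smooth g \<Longrightarrow> (\<And>x. \<bar>g x\<bar> \<le> 1) \<Longrightarrow> (\<And>x y. \<bar>g x - g y\<bar> \<le> dist x y) \<Longrightarrow>
    signed_integral T UNIV g \<le> c"
  shows "flat_norm T \<le> c"
proof -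
  have "gradient (\<lambda>x. 0) x = 0" for x :: 'a by (simp add: gradient_def)
  moreover have "signed_integral T UNIV g \<le> c"
    if "smooth g" "\<forall>x. \<bar>g x\<bar> \<le> 1" "\<forall>x. norm (gradient g x) \<le> 1" for g
    using that norm_gradient_le_iff_Lipschitz[of g 1] by (intro assms) auto
  ultimately show ?thesis unfolding flat_norm_def
    using smooth_const[of 0] by (intro cSup_least) (auto intro!: exI[of _ "\<lambda>x. 0"])
qed

lemma flat_norm_nonneg:
  assumes "finite_signed_borel_measure T" shows "0 \<le> flat_norm T"
proof -
  have "\<bar>signed_integral T UNIV (\<lambda>x. 0)\<bar> \<le> 1 * flat_norm T"
    using assms by (intro abs_signed_integral_smooth_le_flat_norm smooth_const) auto
  then show ?thesis by linarith
qed

lemma flat_norm_le_mass: "finite_signed_borel_measure T \<Longrightarrow> flat_norm T \<le> mass T"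
  using abs_signed_integral_smooth_le_mass[of T _ 1] by (intro flat_norm_le) (auto simp: abs_le_iff)

lemma normal_0_current_signed_measure:
  "T \<in> normal_0_currents K \<Longrightarrow> finite_signed_borel_measure T"
  by (simp add: normal_0_currents_def)

lemma normal_0_currents_add:
  "S \<in> normal_0_currents K \<Longrightarrow> T \<in> normal_0_currents K \<Longrightarrow> (\<lambda>A. S A + T A) \<in> normal_0_currents K"
  by (simp add: normal_0_currents_def signed_measure_add)

lemma normal_0_currents_cmult:
  "T \<in> normal_0_currents K \<Longrightarrow> (\<lambda>A. c * T A) \<in> normal_0_currents K"
  by (simp add: normal_0_currents_def signed_measure_cmult)

lemma dirac_normal_0_current: "x \<in> K \<Longrightarrow> dirac x \<in> normal_0_currents K"
  using signed_measure_dirac[of x] by (auto simp: normal_0_currents_def) (auto simp: dirac_def)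

lemma pushforward_normal_0_current:
  assumes "T \<in> normal_0_currents L" "r \<in> borel_measurable borel" "range r \<subseteq> K"
  shows "signed_pushforward r T \<in> normal_0_currents K"
proof -
  have T: "finite_signed_borel_measure T" using assms(1) by (rule normal_0_current_signed_measure)
  have "signed_pushforward r T A = 0" if "A \<inter> K = {}" for A
  proof -
    have "r -` A = {}" using that assms(3) by auto
    then show ?thesis using signed_measure_empty[OF T] by (simp add: signed_pushforward_def)
  qed
  then show ?thesis using signed_measure_pushforward[OF T assms(2)] by (simp add: normal_0_currents_def)
qed

subsection \<open>Hoelder functions act as charges\<close>

lemma le_if_le_add_epsilon_mult:
  fixes x y z :: real
  assumes "\<And>\<kappa>. 0 < \<kappa> \<Longrightarrow> x \<le> y + \<kappa> * z"
  shows "x \<le> y"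
proof (rule field_le_epsilon)
  fix e :: real assume e: "0 < e"
  have "x \<le> y + e / (\<bar>z\<bar> + 1) * z" using e by (intro assms) simp
  also have "e / (\<bar>z\<bar> + 1) * z \<le> e / (\<bar>z\<bar> + 1) * (\<bar>z\<bar> + 1)"
    using e by (intro mult_left_mono) auto
  also have "\<dots> = e" by simp
  finally show "x \<le> y + e" by simp
qed

lemma bounded_borel_indicator_continuous_on:
  fixes u :: "'a::euclidean_space \<Rightarrow> real"
  assumes "compact K" "continuous_on K u"
  shows "(\<lambda>x. indicator K x * u x) \<in> bounded_borel"
proof -
  have "bounded (u ` K)" using assms by (intro compact_imp_bounded compact_continuous_image)
  then obtain c where c: "0 < c" "\<forall>x\<in>K. \<bar>u x\<bar> \<le> c" by (auto simp: bounded_pos)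
  have "K \<in> sets borel" using assms(1) by (intro borel_closed compact_imp_closed)
  then have "(\<lambda>x. indicator K x *\<^sub>R u x) \<in> borel_measurable borel"
    using assms(2) by (intro borel_measurable_continuous_on_indicator) auto
  then show ?thesis using c by (intro bounded_borelI[of _ c]) (auto simp: indicator_def)
qed

text \<open>A smooth approximant h bounded by c + \<kappa> on the whole space is a test function for
  \<open>mass\<close> up to scaling. The difference u - h is at most 2 * \<kappa> on K, so its
  integral is controlled by the total variation and disappears as \<kappa> tends to 0.\<close>

lemma abs_signed_integral_continuous_le_mass:
  fixes K :: "'a::euclidean_space set"
  assumes K: "compact K" and T: "T \<in> normal_0_currents K"
    and u: "continuous_on K u" and c: "0 \<le> c" "\<And>x. x \<in> K \<Longrightarrow> \<bar>u x\<bar> \<le> c"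
  shows "\<bar>signed_integral T UNIV (\<lambda>x. indicator K x * u x)\<bar> \<le> c * mass T"
proof (rule le_if_le_add_epsilon_mult)
  fix \<kappa> :: real assume \<kappa>: "0 < \<kappa>"
  have fT: "finite_signed_borel_measure T" using T by (rule normal_0_current_signed_measure)
  have Kb: "K \<in> sets borel" using K by (intro borel_closed compact_imp_closed)
  have "uniformly_continuous_on K u" using u K by (intro compact_uniformly_continuous)
  then obtain d where d: "0 < d" "\<And>x y. x \<in> K \<Longrightarrow> y \<in> K \<Longrightarrow> dist y x < d \<Longrightarrow> dist (u y) (u x) < \<kappa>"
    using \<kappa> unfolding uniformly_continuous_on_def by metis
  \<comment> \<open>Beyond distance d the oscillation of u, at most 2 * c = b * d, is absorbed by
    the linear term; below d uniform continuity gives \<kappa>.\<close>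
  define b where "b = 2 * c / d"
  have b: "0 \<le> b" using c(1) d(1) by (simp add: b_def)
  have ub: "u x - u y \<le> \<kappa> + b * dist x y" if "x \<in> K" "y \<in> K" for x y
  proof (cases "dist x y < d")
    case True
    then have "u x - u y < \<kappa>" using d(2)[of y x] that by (auto simp: dist_real_def)
    moreover have "0 \<le> b * dist x y" using b by simp
    ultimately show ?thesis by linarith
  next
    case False
    have "u x - u y \<le> b * d" using c(2)[OF that(1)] c(2)[OF that(2)] d(1) by (simp add: b_def)
    also have "\<dots> \<le> b * dist x y" using False b by (intro mult_left_mono) auto
    finally show ?thesis using \<kappa> by linarith
  qed
  obtain h where h: "smooth h" "\<And>x. \<bar>h x\<bar> \<le> c + \<kappa>" "\<And>x. x \<in> K \<Longrightarrow> \<bar>h x - u x\<bar> \<le> \<kappa> + \<kappa>"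
    using smooth_Lipschitz_approximation[OF K b \<kappa> c(1,2) _ ub] \<kappa> by (metis less_imp_le)
  have hb: "h \<in> bounded_borel" using h(1,2) by (rule smooth_bounded_borel)
  have uh: "continuous_on K (\<lambda>x. u x - h x)"
    using u smooth_imp_continuous_on[OF h(1)] by (intro continuous_intros)
  have "signed_integral T UNIV (\<lambda>x. indicator K x * u x) =
      signed_integral T UNIV (\<lambda>x. indicator K x * h x + indicator K x * (u x - h x))"
    by (simp add: algebra_simps)
  also have "\<dots> = signed_integral T UNIV (\<lambda>x. indicator K x * h x) +
      signed_integral T UNIV (\<lambda>x. indicator K x * (u x - h x))"
    using smooth_imp_continuous_on[OF h(1)] uh
    by (intro signed_integral_add[OF fT] bounded_borel_indicator_continuous_on K)
  also have "signed_integral T UNIV (\<lambda>x. indicator K x * h x) = signed_integral T UNIV h"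
    using signed_integral_concentrated[OF T Kb hb] by simp
  finally have eq: "signed_integral T UNIV (\<lambda>x. indicator K x * u x) = signed_integral T UNIV h +
      signed_integral T UNIV (\<lambda>x. indicator K x * (u x - h x))" .
  have 1: "\<bar>signed_integral T UNIV h\<bar> \<le> (c + \<kappa>) * mass T"
    using h(1,2) c(1) \<kappa> by (intro abs_signed_integral_smooth_le_mass[OF fT]) auto
  have "\<bar>signed_integral T UNIV (\<lambda>x. indicator K x * (u x - h x))\<bar> \<le> (\<kappa> + \<kappa>) * total_variation T"
  proof (rule abs_signed_integral_le[OF fT bounded_borel_indicator_continuous_on[OF K uh]])
    show "\<bar>indicator K x * (u x - h x)\<bar> \<le> \<kappa> + \<kappa>" for x
      using h(3)[of x] \<kappa> by (auto simp: indicator_def abs_minus_commute)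
  qed
  then show "\<bar>signed_integral T UNIV (\<lambda>x. indicator K x * u x)\<bar> \<le>
      c * mass T + \<kappa> * (mass T + 2 * total_variation T)"
    using 1 unfolding eq by (simp add: algebra_simps)
qed

lemma continuous_on_Hoelder:
  fixes f :: "'a::metric_space \<Rightarrow> real"
  assumes "0 < \<alpha>" "0 \<le> A"
    and f: "\<And>x y. x \<in> K \<Longrightarrow> y \<in> K \<Longrightarrow> \<bar>f x - f y\<bar> \<le> A * dist x y powr \<alpha>"
  shows "continuous_on K f"
  unfolding continuous_on_iff
proof (intro ballI allI impI)
  fix x and e :: real assume x: "x \<in> K" and e: "0 < e"
  define d where "d = (e / (A + 1)) powr (1 / \<alpha>)"
  have d: "0 < d" using e assms(2) by (simp add: d_def)
  have "dist (f y) (f x) < e" if y: "y \<in> K" "dist y x < d" for y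
  proof -
    have "dist y x powr \<alpha> < d powr \<alpha>" using y assms(1) by (intro powr_less_mono2) auto
    also have "\<dots> = e / (A + 1)" using assms e by (simp add: d_def powr_powr)
    finally have "A * dist y x powr \<alpha> \<le> A * (e / (A + 1))" using assms(2) by (intro mult_left_mono) auto
    also have "\<dots> < e" using assms(2) e by (simp add: field_simps)
    finally show ?thesis using f[OF y(1) x] by (simp add: dist_real_def)
  qed
  then show "\<exists>d>0. \<forall>y\<in>K. dist y x < d \<longrightarrow> dist (f y) (f x) < e" using d by blast
qed

text \<open>Comparing the distance with \<epsilon> gives dist x y powr \<alpha> \<le> \<epsilon>
  powr \<alpha> + \<epsilon> powr (\<alpha> - 1) * dist x y. This is the hypothesis of the smooth
  approximation with a additive and b linear: g is tested against the flat norm, and f - g, which is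
  merely continuous on K, against the mass.\<close>

lemma abs_signed_integral_Hoelder_interpolation:
  fixes K :: "'a::euclidean_space set"
  assumes K: "compact K" and T: "T \<in> normal_0_currents K" and \<alpha>: "0 < \<alpha>" "\<alpha> \<le> 1"
    and A: "0 \<le> A" and f0: "\<And>x. x \<notin> K \<Longrightarrow> f x = 0" and fA: "\<And>x. x \<in> K \<Longrightarrow> \<bar>f x\<bar> \<le> A"
    and f: "\<And>x y. x \<in> K \<Longrightarrow> y \<in> K \<Longrightarrow> \<bar>f x - f y\<bar> \<le> A * dist x y powr \<alpha>"
    and \<epsilon>: "0 < \<epsilon>" "\<epsilon> \<le> 1"
  shows "\<bar>signed_integral T UNIV f\<bar> \<le>
    A * (\<epsilon> powr \<alpha> * mass T + \<epsilon> powr (\<alpha> - 1) * flat_norm T)"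
proof (rule le_if_le_add_epsilon_mult)
  fix \<kappa> :: real assume \<kappa>: "0 < \<kappa>"
  have fT: "finite_signed_borel_measure T" using T by (rule normal_0_current_signed_measure)
  have Kb: "K \<in> sets borel" using K by (intro borel_closed compact_imp_closed)
  have fc: "continuous_on K f" using \<alpha>(1) A f by (rule continuous_on_Hoelder)
  define a where "a = A * \<epsilon> powr \<alpha>"
  define b where "b = A * \<epsilon> powr (\<alpha> - 1)"
  have a: "0 \<le> a" and b: "0 \<le> b" using A by (auto simp: a_def b_def)
  have fab: "f x - f y \<le> a + b * dist x y" if "x \<in> K" "y \<in> K" for x y
  proof -
    have "dist x y powr \<alpha> \<le> \<epsilon> powr \<alpha> + \<epsilon> powr (\<alpha> - 1) * dist x y"
    proof (cases "dist x y \<le> \<epsilon>")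
      case True
      then have "dist x y powr \<alpha> \<le> \<epsilon> powr \<alpha>" using \<alpha> by (intro powr_mono2) auto
      then show ?thesis by (simp add: add_increasing2)
    next
      case False
      have "dist x y powr \<alpha> = dist x y powr (\<alpha> - 1) * dist x y powr 1"
        by (simp only: powr_add[symmetric]) simp
      also have "\<dots> = dist x y powr (\<alpha> - 1) * dist x y" by simp
      also have "\<dots> \<le> \<epsilon> powr (\<alpha> - 1) * dist x y"
        using False \<epsilon> \<alpha> by (intro mult_right_mono powr_mono2') auto
      finally show ?thesis by (simp add: add_increasing)
    qed
    then have "A * dist x y powr \<alpha> \<le> A * (\<epsilon> powr \<alpha> + \<epsilon> powr (\<alpha> - 1) * dist x y)"
      using A by (rule mult_left_mono)
    then show ?thesis using f[OF that] by (simp add: a_def b_def algebra_simps)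
  qed
  obtain g where g: "smooth g" "\<And>x. \<bar>g x\<bar> \<le> A + \<kappa>" "\<And>x y. \<bar>g x - g y\<bar> \<le> b * dist x y"
    "\<And>x. x \<in> K \<Longrightarrow> \<bar>g x - f x\<bar> \<le> a + \<kappa>"
    using smooth_Lipschitz_approximation[OF K b \<kappa> A fA a fab] by metis
  have gb: "g \<in> bounded_borel" using g(1,2) by (rule smooth_bounded_borel)
  have fg: "continuous_on K (\<lambda>x. f x - g x)"
    using fc smooth_imp_continuous_on[OF g(1)] by (intro continuous_intros)
  have "f = (\<lambda>x. indicator K x * g x + indicator K x * (f x - g x))"
    using f0 by (auto simp: indicator_def)
  then have "signed_integral T UNIV f =
      signed_integral T UNIV (\<lambda>x. indicator K x * g x + indicator K x * (f x - g x))"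
    by (rule arg_cong)
  also have "\<dots> = signed_integral T UNIV (\<lambda>x. indicator K x * g x) +
      signed_integral T UNIV (\<lambda>x. indicator K x * (f x - g x))"
    using smooth_imp_continuous_on[OF g(1)] fg
    by (intro signed_integral_add[OF fT] bounded_borel_indicator_continuous_on K)
  also have "signed_integral T UNIV (\<lambda>x. indicator K x * g x) = signed_integral T UNIV g"
    using signed_integral_concentrated[OF T Kb gb] by simp
  finally have eq: "signed_integral T UNIV f = signed_integral T UNIV g +
      signed_integral T UNIV (\<lambda>x. indicator K x * (f x - g x))" .
  \<comment> \<open>Here \<epsilon> \<le> 1 enters: it gives A \<le> b, so that the single constant
    b + \<kappa> dominates both the size and the slope of g, as the flat norm demands.\<close>
  have "1 \<le> \<epsilon> powr (\<alpha> - 1)" using powr_mono2'[of "\<alpha> - 1" \<epsilon> 1] \<epsilon> \<alpha> by simp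
  then have Ab: "A \<le> b" using mult_left_mono[of 1 "\<epsilon> powr (\<alpha> - 1)" A] A by (simp add: b_def)
  have 1: "\<bar>signed_integral T UNIV g\<bar> \<le> (b + \<kappa>) * flat_norm T"
  proof (rule abs_signed_integral_smooth_le_flat_norm[OF fT g(1)])
    show "\<bar>g x\<bar> \<le> b + \<kappa>" for x using g(2)[of x] Ab by linarith
    show "\<bar>g x - g y\<bar> \<le> (b + \<kappa>) * dist x y" for x y
      using g(3)[of x y] \<kappa> by (simp add: distrib_right add_increasing2)
  qed (use b \<kappa> in simp)
  have 2: "\<bar>signed_integral T UNIV (\<lambda>x. indicator K x * (f x - g x))\<bar> \<le> (a + \<kappa>) * mass T"
    using g(4) a \<kappa>
    by (intro abs_signed_integral_continuous_le_mass[OF K T fg]) (auto simp: abs_minus_commute)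
  show "\<bar>signed_integral T UNIV f\<bar> \<le>
      A * (\<epsilon> powr \<alpha> * mass T + \<epsilon> powr (\<alpha> - 1) * flat_norm T) + \<kappa> * (mass T + flat_norm T)"
    using 1 2 unfolding eq by (simp add: a_def b_def algebra_simps)
qed

lemma le_0_if_le_mult_powr:
  fixes x B :: real
  assumes "0 < \<alpha>" "\<And>\<epsilon>. 0 < \<epsilon> \<Longrightarrow> \<epsilon> \<le> 1 \<Longrightarrow> x \<le> B * \<epsilon> powr \<alpha>"
  shows "x \<le> 0"
proof (rule le_if_le_add_epsilon_mult)
  fix \<kappa> :: real assume \<kappa>: "0 < \<kappa>"
  define \<epsilon> where "\<epsilon> = min 1 \<kappa> powr (1 / \<alpha>)"
  have "\<epsilon> \<le> 1 powr (1 / \<alpha>)" unfolding \<epsilon>_def using \<kappa> assms(1) by (intro powr_mono2) auto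
  then have "x \<le> B * \<epsilon> powr \<alpha>" using \<kappa> by (intro assms(2)) (auto simp: \<epsilon>_def)
  also have "\<epsilon> powr \<alpha> = min 1 \<kappa>" using \<kappa> assms(1) by (simp add: \<epsilon>_def powr_powr)
  also have "B * min 1 \<kappa> \<le> \<kappa> * \<bar>B\<bar>"
    using \<kappa> mult_mono[of B "\<bar>B\<bar>" "min 1 \<kappa>" \<kappa>] by (simp add: mult.commute)
  finally show "x \<le> 0 + \<kappa> * \<bar>B\<bar>" by simp
qed

lemma abs_signed_integral_Hoelder_le:
  fixes K :: "'a::euclidean_space set"
  assumes K: "compact K" and T: "T \<in> normal_0_currents K" and \<alpha>: "0 < \<alpha>" "\<alpha> \<le> 1"
    and A: "0 \<le> A" and f0: "\<And>x. x \<notin> K \<Longrightarrow> f x = 0" and fA: "\<And>x. x \<in> K \<Longrightarrow> \<bar>f x\<bar> \<le> A"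
    and f: "\<And>x y. x \<in> K \<Longrightarrow> y \<in> K \<Longrightarrow> \<bar>f x - f y\<bar> \<le> A * dist x y powr \<alpha>"
  shows "\<bar>signed_integral T UNIV f\<bar> \<le> 2 * A * mass T powr (1 - \<alpha>) * flat_norm T powr \<alpha>"
proof -
  note fT = normal_0_current_signed_measure[OF T]
  have interp: "\<bar>signed_integral T UNIV f\<bar> \<le>
      A * (\<epsilon> powr \<alpha> * mass T + \<epsilon> powr (\<alpha> - 1) * flat_norm T)" if "0 < \<epsilon>" "\<epsilon> \<le> 1" for \<epsilon>
    using K T \<alpha> A f0 fA f that by (rule abs_signed_integral_Hoelder_interpolation)
  \<comment> \<open>With F(T) = 0 the balancing value \<epsilon> = F(T) / M(T) is not positive. Then
    only the mass term of the interpolation remains, and it vanishes as \<epsilon> tends to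
    0.\<close>
  consider "flat_norm T = 0" | "0 < flat_norm T" using flat_norm_nonneg[OF fT] by linarith
  then show ?thesis
  proof cases
    case 1
    have "\<bar>signed_integral T UNIV f\<bar> \<le> 0"
    proof (rule le_0_if_le_mult_powr[OF \<alpha>(1)])
      show "\<bar>signed_integral T UNIV f\<bar> \<le> (A * mass T) * \<epsilon> powr \<alpha>" if "0 < \<epsilon>" "\<epsilon> \<le> 1" for \<epsilon>
        using interp[OF that] 1 by (simp add: mult_ac)
    qed
    then show ?thesis using 1 by simp
  next
    case 2
    define M where "M = mass T"
    define F where "F = flat_norm T"
    have F: "0 < F" and FM: "F \<le> M" using 2 flat_norm_le_mass[OF fT] by (auto simp: F_def M_def)
    then have M: "0 < M" by linarith
    have "\<bar>signed_integral T UNIV f\<bar> \<le> A * ((F / M) powr \<alpha> * M + (F / M) powr (\<alpha> - 1) * F)"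
      unfolding F_def M_def using F M FM by (intro interp) (auto simp: F_def M_def)
    also have "(F / M) powr \<alpha> * M = M powr (1 - \<alpha>) * F powr \<alpha>"
      using F M by (simp add: powr_divide powr_diff)
    also have "(F / M) powr (\<alpha> - 1) * F = M powr (1 - \<alpha>) * F powr \<alpha>"
      using F M by (simp add: powr_divide powr_diff)
    finally show ?thesis by (simp add: F_def M_def mult_ac)
  qed
qed

section \<open>Pointwise description of the Hoelder norm\<close>

lemma Lip_space_bounds:
  fixes K :: "'a::metric_space set"
  assumes K: "compact K" and \<alpha>: "0 < \<alpha>" and f: "f \<in> Lip_space K \<alpha>"
  shows "0 \<le> Lip_norm K \<alpha> f" "\<And>x. x \<in> K \<Longrightarrow> \<bar>f x\<bar> \<le> Lip_norm K \<alpha> f"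
    "\<And>x y. x \<in> K \<Longrightarrow> y \<in> K \<Longrightarrow> \<bar>f x - f y\<bar> \<le> Lip_norm K \<alpha> f * dist x y powr \<alpha>"
    "\<And>x. x \<notin> K \<Longrightarrow> f x = 0" "continuous_on K f"
proof -
  have bdd: "bdd_above (insert 0 (holder_quotients K \<alpha> f))" using f by (simp add: Lip_space_def)
  have L0: "0 \<le> Lip_seminorm K \<alpha> f" unfolding Lip_seminorm_def by (rule cSup_upper[OF _ bdd]) simp
  have L: "\<bar>f x - f y\<bar> \<le> Lip_seminorm K \<alpha> f * dist x y powr \<alpha>" if "x \<in> K" "y \<in> K" for x y
  proof (cases "x = y")
    case False
    then have "\<bar>f x - f y\<bar> / dist x y powr \<alpha> \<le> Lip_seminorm K \<alpha> f" unfolding Lip_seminorm_def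
      using that by (intro cSup_upper[OF _ bdd]) (auto simp: holder_quotients_def)
    then show ?thesis using False by (simp add: pos_divide_le_eq)
  qed simp
  \<comment> \<open>Continuity comes first: boundedness of f is not part of
    \<open>Lip_space\<close>, and without it the \<open>Sup\<close> in \<open>sup_norm_on\<close>
    would not be an upper bound. Compactness of K supplies it.\<close>
  show c: "continuous_on K f" using \<alpha> L0 L by (rule continuous_on_Hoelder)
  then have "bounded (f ` K)" using K by (intro compact_imp_bounded compact_continuous_image)
  then have "bdd_above ((\<lambda>x. \<bar>f x\<bar>) ` K)" by (auto simp: bounded_iff bdd_above_def)
  then have bdd': "bdd_above (insert 0 ((\<lambda>x. \<bar>f x\<bar>) ` K))" by simp
  show "0 \<le> Lip_norm K \<alpha> f" using L0 by (simp add: Lip_norm_def)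
  show "\<bar>f x\<bar> \<le> Lip_norm K \<alpha> f" if "x \<in> K" for x
  proof -
    have "\<bar>f x\<bar> \<le> sup_norm_on K f" unfolding sup_norm_on_def
      using that by (intro cSup_upper[OF _ bdd']) auto
    then show ?thesis by (simp add: Lip_norm_def)
  qed
  show "\<bar>f x - f y\<bar> \<le> Lip_norm K \<alpha> f * dist x y powr \<alpha>" if "x \<in> K" "y \<in> K" for x y
    by (rule order_trans[OF L[OF that]]) (auto simp: Lip_norm_def intro!: mult_right_mono)
  show "f x = 0" if "x \<notin> K" for x using f that by (simp add: Lip_space_def)
qed

lemma Lip_space_intro:
  fixes K :: "'a::metric_space set"
  assumes A: "0 \<le> A" and f0: "\<And>x. x \<notin> K \<Longrightarrow> f x = 0" and fA: "\<And>x. x \<in> K \<Longrightarrow> \<bar>f x\<bar> \<le> A"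
    and f: "\<And>x y. x \<in> K \<Longrightarrow> y \<in> K \<Longrightarrow> \<bar>f x - f y\<bar> \<le> A * dist x y powr \<alpha>"
  shows "f \<in> Lip_space K \<alpha>" "Lip_norm K \<alpha> f \<le> A"
proof -
  have q: "s \<le> A" if "s \<in> holder_quotients K \<alpha> f" for s
    using that f by (auto simp: holder_quotients_def pos_divide_le_eq)
  then have "bdd_above (holder_quotients K \<alpha> f)" by (auto simp: bdd_above_def)
  then show "f \<in> Lip_space K \<alpha>" using f0 by (simp add: Lip_space_def)
  have "Lip_seminorm K \<alpha> f \<le> A" unfolding Lip_seminorm_def
    using q A by (intro cSup_least) auto
  moreover have "sup_norm_on K f \<le> A" unfolding sup_norm_on_def
    using fA A by (intro cSup_least) auto
  ultimately show "Lip_norm K \<alpha> f \<le> A" by (simp add: Lip_norm_def)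
qed

subsection \<open>Charges are determined by Dirac masses\<close>

lemma charge_bound_dirac:
  fixes K :: "'a::euclidean_space set"
  assumes \<omega>: "charge_bound K \<alpha> \<omega> C" and \<alpha>: "0 < \<alpha>" "\<alpha> \<le> 1" and x: "x \<in> K"
  shows "\<bar>\<omega> (dirac x)\<bar> \<le> C"
proof -
  have C: "0 \<le> C" using \<omega> by (simp add: charge_bound_def)
  have "signed_integral (dirac x) UNIV g \<le> 1" if "smooth g" "\<And>x. \<bar>g x\<bar> \<le> 1" for g
    using signed_integral_dirac[OF smooth_bounded_borel[OF that], of x] that(2)[of x] by simp
  then have M: "mass (dirac x) \<le> 1" by (rule mass_le)
  have F: "flat_norm (dirac x) \<le> 1" using flat_norm_le_mass[OF signed_measure_dirac] M by (rule order_trans)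
  have "\<bar>\<omega> (dirac x)\<bar> \<le> C * mass (dirac x) powr (1 - \<alpha>) * flat_norm (dirac x) powr \<alpha>"
    using \<omega> dirac_normal_0_current[OF x] by (simp add: charge_bound_def)
  also have "\<dots> \<le> C * 1 * 1"
    using C M F \<alpha> mass_nonneg[OF signed_measure_dirac, of x] flat_norm_nonneg[OF signed_measure_dirac, of x]
    by (intro mult_mono powr_le1) auto
  finally show ?thesis by simp
qed

lemma charge_bound_dirac_diff:
  fixes K :: "'a::euclidean_space set"
  assumes \<omega>: "charge_bound K \<alpha> \<omega> C" and \<alpha>: "0 < \<alpha>" "\<alpha> \<le> 1" and x: "x \<in> K" and y: "y \<in> K"
  shows "\<bar>\<omega> (\<lambda>A. dirac x A + (- 1) * dirac y A)\<bar> \<le> 2 * C * dist x y powr \<alpha>"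
proof -
  define S where "S = (\<lambda>A. dirac x A + (- 1) * dirac y A)"
  have C: "0 \<le> C" using \<omega> by (simp add: charge_bound_def)
  have S: "S \<in> normal_0_currents K" unfolding S_def
    by (intro normal_0_currents_add normal_0_currents_cmult dirac_normal_0_current x y)
  have int: "signed_integral S UNIV g = g x - g y" if "g \<in> bounded_borel" for g
    unfolding S_def
    using signed_integral_measure_add[OF signed_measure_dirac signed_measure_cmult[OF signed_measure_dirac] that]
      signed_integral_measure_cmult[OF signed_measure_dirac that] signed_integral_dirac[OF that]
    by (metis minus_real_def mult_minus1)
  have M: "mass S \<le> 2"
  proof (rule mass_le)
    show "signed_integral S UNIV g \<le> 2" if "smooth g" "\<And>x. \<bar>g x\<bar> \<le> 1" for g
      using int[OF smooth_bounded_borel[OF that]] that(2)[of x] that(2)[of y] by linarith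
  qed
  have F: "flat_norm S \<le> dist x y"
  proof (rule flat_norm_le)
    show "signed_integral S UNIV g \<le> dist x y"
      if "smooth g" "\<And>x. \<bar>g x\<bar> \<le> 1" "\<And>x y. \<bar>g x - g y\<bar> \<le> dist x y" for g
      using int[OF smooth_bounded_borel[OF that(1,2)]] that(3)[of x y] by linarith
  qed
  note nn = mass_nonneg[OF normal_0_current_signed_measure[OF S]]
    flat_norm_nonneg[OF normal_0_current_signed_measure[OF S]]
  \<comment> \<open>Rounding 2 powr (1 - \<alpha>) up to 2 makes the constant independent of
    \<alpha>.\<close>
  have "mass S powr (1 - \<alpha>) \<le> 2 powr (1 - \<alpha>)" using M nn \<alpha> by (intro powr_mono2) auto
  also have "\<dots> \<le> 2 powr 1" using \<alpha> by (intro powr_mono) auto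
  finally have M2: "mass S powr (1 - \<alpha>) \<le> 2" by simp
  have "\<bar>\<omega> S\<bar> \<le> C * mass S powr (1 - \<alpha>) * flat_norm S powr \<alpha>"
    using \<omega> S by (simp add: charge_bound_def)
  also have "\<dots> \<le> C * 2 * dist x y powr \<alpha>"
    using C M2 F nn \<alpha> by (intro mult_mono powr_mono2) auto
  finally show ?thesis by (simp add: S_def mult_ac)
qed

text \<open>A Borel choice of a nearby centre, built by letting each new ball override the earlier
  choice. Points outside all balls receive some centre too, for which F has to be nonempty.\<close>

lemma finite_range_near_identity:
  fixes F :: "'a::metric_space set"
  assumes "finite F" "F \<noteq> {}"
  shows "\<exists>r\<in>borel_measurable borel. range r \<subseteq> F \<and> (\<forall>x\<in>(\<Union>y\<in>F. ball y \<eta>). dist (r x) x < \<eta>)"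
  using assms
proof (induction F rule: finite_ne_induct)
  case (singleton y)
  show ?case by (intro bexI[of _ "\<lambda>_. y"]) auto
next
  case (insert y F)
  then obtain r where r: "r \<in> borel_measurable borel" "range r \<subseteq> F"
    "\<forall>x\<in>(\<Union>y\<in>F. ball y \<eta>). dist (r x) x < \<eta>" by blast
  have "(\<lambda>x. if x \<in> ball y \<eta> then y else r x) \<in> borel_measurable borel"
    using r(1) by (intro measurable_If_set) auto
  then show ?case using r(2,3)
    by (intro bexI[of _ "\<lambda>x. if x \<in> ball y \<eta> then y else r x"]) auto
qed

lemma signed_measure_finite_UN:
  assumes T: "finite_signed_borel_measure T" and G: "finite G"
    and B: "\<And>y. y \<in> G \<Longrightarrow> B y \<in> sets borel" "disjoint_family_on B G"
  shows "T (\<Union>y\<in>G. B y) = (\<Sum>y\<in>G. T (B y))"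
  using G B
proof (induction G rule: finite_induct)
  case empty
  then show ?case using signed_measure_empty[OF T] by simp
next
  case (insert y G)
  have "T (B y \<union> (\<Union>y\<in>G. B y)) = T (B y) + T (\<Union>y\<in>G. B y)"
    using insert by (intro signed_measure_Un[OF T]) (auto simp: disjoint_family_on_def)
  then show ?case using insert by (auto simp: disjoint_family_on_def)
qed

text \<open>The preimage of A is the finite disjoint union of the fibres over F \<inter> A. The
  fibres are Borel because singletons are closed in a \<open>t1_space\<close>.\<close>

lemma pushforward_finite_range:
  fixes r :: "'a::topological_space \<Rightarrow> 'b::t1_space"
  assumes T: "finite_signed_borel_measure T" and r: "r \<in> borel_measurable borel"
    and F: "finite F" "range r \<subseteq> F"
  shows "signed_pushforward r T = (\<lambda>A. \<Sum>y\<in>F. T (r -` {y}) * dirac y A)"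
proof
  fix A
  show "signed_pushforward r T A = (\<Sum>y\<in>F. T (r -` {y}) * dirac y A)"
  proof (cases "A \<in> sets borel")
    case True
    have "r -` A = (\<Union>y\<in>F \<inter> A. r -` {y})" using F(2) by auto
    then have "T (r -` A) = (\<Sum>y\<in>F \<inter> A. T (r -` {y}))"
      using F(1) borel_vimage[OF r]
      by (simp only:) (intro signed_measure_finite_UN[OF T], auto simp: disjoint_family_on_def)
    also have "\<dots> = (\<Sum>y\<in>F. if y \<in> A then T (r -` {y}) else 0)"
      using F(1) by (simp add: sum.inter_restrict)
    also have "\<dots> = (\<Sum>y\<in>F. T (r -` {y}) * dirac y A)"
      using True by (intro sum.cong) (auto simp: dirac_def)
    finally show ?thesis using True by (simp add: signed_pushforward_def)
  next
    case False
    then show ?thesis by (simp add: signed_pushforward_def dirac_def)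
  qed
qed

lemma linear_functional_dirac_sum_eq_0:
  assumes add: "\<And>S T. S \<in> normal_0_currents K \<Longrightarrow> T \<in> normal_0_currents K \<Longrightarrow>
      \<omega> (\<lambda>A. S A + T A) = \<omega> S + \<omega> T"
    and cmult: "\<And>c T. T \<in> normal_0_currents K \<Longrightarrow> \<omega> (\<lambda>A. c * T A) = c * (\<omega> T :: real)"
    and dirac: "\<And>x. x \<in> K \<Longrightarrow> \<omega> (dirac x) = 0"
    and F: "finite F" "F \<subseteq> K"
  shows "(\<lambda>A. \<Sum>y\<in>F. c y * dirac y A) \<in> normal_0_currents K \<and> \<omega> (\<lambda>A. \<Sum>y\<in>F. c y * dirac y A) = 0"
  using F
proof (induction F rule: finite_induct)
  case empty
  have "(\<lambda>A. 0) \<in> normal_0_currents K"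
    by (simp add: normal_0_currents_def finite_signed_borel_measure_def)
  then show ?case using cmult[of "\<lambda>A. 0" 0] by simp
next
  case (insert y F)
  have d: "dirac y \<in> normal_0_currents K" using insert by (intro dirac_normal_0_current) auto
  have 1: "(\<lambda>A. c y * dirac y A) \<in> normal_0_currents K" "\<omega> (\<lambda>A. c y * dirac y A) = 0"
    using normal_0_currents_cmult[OF d] cmult[OF d, of "c y"] dirac[of y] insert.prems by auto
  show ?case using insert normal_0_currents_add[OF 1(1)] add[OF 1(1)] 1(2) by simp
qed

text \<open>
  Every current is flat-close to its push-forward under a finite-valued map near the identity,
  which is a combination of Dirac masses and whose mass does not blow up.
\<close>

lemma charge_eq_0_if_dirac_eq_0:
  fixes K :: "'a::euclidean_space set"
  assumes K: "compact K" and \<alpha>: "0 < \<alpha>" "\<alpha> \<le> 1"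
    and add: "\<And>S T. S \<in> normal_0_currents K \<Longrightarrow> T \<in> normal_0_currents K \<Longrightarrow>
      \<omega> (\<lambda>A. S A + T A) = \<omega> S + \<omega> T"
    and cmult: "\<And>c T. T \<in> normal_0_currents K \<Longrightarrow> \<omega> (\<lambda>A. c * T A) = c * \<omega> T"
    and \<omega>: "charge_bound K \<alpha> \<omega> C"
    and dirac: "\<And>x. x \<in> K \<Longrightarrow> \<omega> (dirac x) = 0"
    and T: "T \<in> normal_0_currents K"
  shows "\<omega> T = 0"
proof (cases "K = {}")
  \<comment> \<open>Without points in K there is no net point to map to. All Borel sets miss K, so T
    is the zero current.\<close>
  case True
  have "T A = 0" for A
    using T True by (cases "A \<in> sets borel") (auto simp: normal_0_currents_def finite_signed_borel_measure_def)
  then have "T = (\<lambda>A. 0 * T A)" by auto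
  then show ?thesis using cmult[OF T, of 0] by simp
next
  case False
  note fT = normal_0_current_signed_measure[OF T]
  have Kb: "K \<in> sets borel" using K by (intro borel_closed compact_imp_closed)
  have C: "0 \<le> C" using \<omega> by (simp add: charge_bound_def)
  define V where "V = total_variation T"
  have V: "0 \<le> V" by (simp add: V_def total_variation_nonneg)
  have "\<bar>\<omega> T\<bar> \<le> 0"
  proof (rule le_0_if_le_mult_powr[OF \<alpha>(1)])
    fix \<eta> :: real assume \<eta>: "0 < \<eta>"
    obtain F where F: "finite F" "F \<subseteq> K" "K \<subseteq> (\<Union>y\<in>F. ball y \<eta>)"
      using compact_finite_net[OF K \<eta>] by blast
    have "F \<noteq> {}" using F(3) False by auto
    then obtain r where r: "r \<in> borel_measurable borel" "range r \<subseteq> F"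
      "\<forall>x\<in>(\<Union>y\<in>F. ball y \<eta>). dist (r x) x < \<eta>"
      using finite_range_near_identity[OF F(1)] by blast
    define R where "R = signed_pushforward r T"
    have R: "R \<in> normal_0_currents K" unfolding R_def
      using r(1,2) F(2) by (intro pushforward_normal_0_current[OF T]) auto
    have "\<omega> R = 0" unfolding R_def pushforward_finite_range[OF fT r(1) F(1) r(2)]
      using add cmult dirac F(1,2) by (rule linear_functional_dirac_sum_eq_0[THEN conjunct2])
    define S where "S = (\<lambda>A. T A + (- 1) * R A)"
    have S: "S \<in> normal_0_currents K" unfolding S_def
      by (intro normal_0_currents_add normal_0_currents_cmult T R)
    note fS = normal_0_current_signed_measure[OF S] and fR = normal_0_current_signed_measure[OF R]
    have "\<omega> S = \<omega> T" unfolding S_def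
      unfolding add[OF T normal_0_currents_cmult[OF R]] cmult[OF R] using \<open>\<omega> R = 0\<close> by simp
    \<comment> \<open>Integrating g against T - R amounts to integrating the displacement g x - g (r
      x) against T, and only points of K count. The crude displacement 2 bounds the mass of S; the
      displacement \<eta> of 1-Lipschitz functions bounds its flat norm.\<close>
    have int: "signed_integral S UNIV g \<le> c * V"
      if g: "g \<in> bounded_borel" and c: "0 \<le> c" "\<And>x. x \<in> K \<Longrightarrow> \<bar>g x - g (r x)\<bar> \<le> c" for g c
    proof -
      have gr: "(\<lambda>x. g (r x)) \<in> bounded_borel" using bounded_borel_compose[OF g r(1)] .
      have "signed_integral S UNIV g = signed_integral T UNIV g + (- 1) * signed_integral R UNIV g"
        unfolding S_def using signed_integral_measure_add[OF fT signed_measure_cmult[OF fR] g]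
          signed_integral_measure_cmult[OF fR g] by metis
      also have "\<dots> = signed_integral T UNIV (\<lambda>x. g x - g (r x))"
        unfolding R_def using signed_integral_pushforward[OF fT r(1) g] signed_integral_diff[OF fT g gr] by simp
      also have "\<dots> = signed_integral T UNIV (\<lambda>x. indicator K x * (g x - g (r x)))"
        by (rule signed_integral_concentrated[OF T Kb bounded_borel_diff[OF g gr]])
      also have "\<dots> \<le> \<bar>\<dots>\<bar>" by simp
      also have "\<dots> \<le> c * V" unfolding V_def
      proof (rule abs_signed_integral_le[OF fT])
        show "(\<lambda>x. indicator K x * (g x - g (r x))) \<in> bounded_borel"
          by (rule bounded_borel_mult[OF bounded_borel_indicator[OF Kb] bounded_borel_diff[OF g gr]])
        show "\<bar>indicator K x * (g x - g (r x))\<bar> \<le> c" for x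
          using c by (auto simp: indicator_def)
      qed
      finally show ?thesis .
    qed
    have M: "mass S \<le> 2 * V"
    proof (rule mass_le)
      fix g :: "'a \<Rightarrow> real" assume g: "smooth g" "\<And>x. \<bar>g x\<bar> \<le> 1"
      have "\<bar>g x - g (r x)\<bar> \<le> 2" for x using g(2)[of x] g(2)[of "r x"] by linarith
      then show "signed_integral S UNIV g \<le> 2 * V" by (intro int[OF smooth_bounded_borel[OF g]]) auto
    qed
    have F: "flat_norm S \<le> \<eta> * V"
    proof (rule flat_norm_le)
      fix g :: "'a \<Rightarrow> real"
      assume g: "smooth g" "\<And>x. \<bar>g x\<bar> \<le> 1" "\<And>x y. \<bar>g x - g y\<bar> \<le> dist x y"
      have "\<bar>g x - g (r x)\<bar> \<le> \<eta>" if "x \<in> K" for x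
      proof -
        have "dist (r x) x < \<eta>" using r(3) F(3) that by blast
        then show ?thesis using g(3)[of x "r x"] by (simp add: dist_commute)
      qed
      then show "signed_integral S UNIV g \<le> \<eta> * V"
        using \<eta> by (intro int[OF smooth_bounded_borel[OF g(1,2)]]) auto
    qed
    have "\<bar>\<omega> S\<bar> \<le> C * mass S powr (1 - \<alpha>) * flat_norm S powr \<alpha>"
      using \<omega> S by (simp add: charge_bound_def)
    also have "\<dots> \<le> C * (2 * V) powr (1 - \<alpha>) * (\<eta> * V) powr \<alpha>"
      using C M F V \<alpha> mass_nonneg[OF fS] flat_norm_nonneg[OF fS] by (intro mult_mono powr_mono2) auto
    also have "\<dots> = (C * (2 * V) powr (1 - \<alpha>) * V powr \<alpha>) * \<eta> powr \<alpha>"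
      using \<eta> V by (simp add: powr_mult mult_ac)
    finally show "\<bar>\<omega> T\<bar> \<le> (C * (2 * V) powr (1 - \<alpha>) * V powr \<alpha>) * \<eta> powr \<alpha>"
      using \<open>\<omega> S = \<omega> T\<close> by simp
  qed
  then show ?thesis by simp
qed

section \<open>The map \<Lambda> and its inverse\<close>

lemma Lip_space_bounded_borel:
  fixes K :: "'a::euclidean_space set"
  assumes K: "compact K" and \<alpha>: "0 < \<alpha>" and f: "f \<in> Lip_space K \<alpha>"
  shows "f \<in> bounded_borel"
proof -
  have "(\<lambda>x. indicator K x * f x) = f"
    using Lip_space_bounds(4)[OF K \<alpha> f] by (intro ext) (auto simp: indicator_def)
  then show ?thesis
    using bounded_borel_indicator_continuous_on[OF K Lip_space_bounds(5)[OF K \<alpha> f]] by simp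
qed

lemma Lambda_map_eq:
  fixes K :: "'a::euclidean_space set"
  assumes K: "compact K" and \<alpha>: "0 < \<alpha>" and f: "f \<in> Lip_space K \<alpha>"
  shows "Lambda_map K f = (\<lambda>T. if T \<in> normal_0_currents K then signed_integral T UNIV f else 0)"
proof -
  have "(\<lambda>x. indicator K x * f x) = f"
    using Lip_space_bounds(4)[OF K \<alpha> f] by (intro ext) (auto simp: indicator_def)
  then have "signed_integral T K f = signed_integral T UNIV f" for T
    by (simp add: signed_integral_eq_UNIV[of T K])
  then show ?thesis by (simp only: Lambda_map_def)
qed

text \<open>Gives injectivity of \<Lambda>, and shows that a charge and its candidate representation
  agree on Dirac masses.\<close>

lemma Lambda_map_dirac:
  fixes K :: "'a::euclidean_space set"
  assumes "compact K" "0 < \<alpha>" "f \<in> Lip_space K \<alpha>" "x \<in> K"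
  shows "Lambda_map K f (dirac x) = f x"
  using Lambda_map_eq[OF assms(1-3)] dirac_normal_0_current[OF assms(4)]
    signed_integral_dirac[OF Lip_space_bounded_borel[OF assms(1-3)]] by simp

lemma charge_bound_Lambda_map:
  fixes K :: "'a::euclidean_space set"
  assumes K: "compact K" and \<alpha>: "0 < \<alpha>" "\<alpha> \<le> 1" and f: "f \<in> Lip_space K \<alpha>"
  shows "charge_bound K \<alpha> (Lambda_map K f) (2 * Lip_norm K \<alpha> f)"
proof -
  note b = Lip_space_bounds[OF K \<alpha>(1) f]
  have "\<bar>signed_integral T UNIV f\<bar> \<le>
      2 * Lip_norm K \<alpha> f * mass T powr (1 - \<alpha>) * flat_norm T powr \<alpha>"
    if "T \<in> normal_0_currents K" for T
    using K that \<alpha> b(1,4,2,3) by (rule abs_signed_integral_Hoelder_le)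
  then show ?thesis using b(1) by (simp add: charge_bound_def Lambda_map_eq[OF K \<alpha>(1) f])
qed

lemma Lambda_map_in_charge_space:
  fixes K :: "'a::euclidean_space set"
  assumes K: "compact K" and \<alpha>: "0 < \<alpha>" "\<alpha> \<le> 1" and f: "f \<in> Lip_space K \<alpha>"
  shows "Lambda_map K f \<in> charge_space K \<alpha>"
proof -
  note fb = Lip_space_bounded_borel[OF K \<alpha>(1) f]
  show ?thesis
    unfolding charge_space_def
    using charge_bound_Lambda_map[OF assms] signed_integral_measure_add[OF _ _ fb]
      signed_integral_measure_cmult[OF _ fb]
    by (auto simp: Lambda_map_eq[OF K \<alpha>(1) f] normal_0_currents_add normal_0_currents_cmult
        normal_0_current_signed_measure)
qed

text \<open>The function f depends on \<omega> alone, so the norm estimate holds for every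
  admissible C at once; this is what later permits passing to the infimum in
  \<open>charge_norm\<close>.\<close>

lemma charge_space_represented:
  fixes K :: "'a::euclidean_space set"
  assumes K: "compact K" and \<alpha>: "0 < \<alpha>" "\<alpha> \<le> 1" and \<omega>: "\<omega> \<in> charge_space K \<alpha>"
  obtains f where "f \<in> Lip_space K \<alpha>" "Lambda_map K f = \<omega>"
    "\<And>C. charge_bound K \<alpha> \<omega> C \<Longrightarrow> Lip_norm K \<alpha> f \<le> 2 * C"
proof -
  have add: "\<omega> (\<lambda>A. S A + T A) = \<omega> S + \<omega> T"
    if "S \<in> normal_0_currents K" "T \<in> normal_0_currents K" for S T
    using \<omega> that by (simp add: charge_space_def)
  have cmult: "\<omega> (\<lambda>A. c * T A) = c * \<omega> T" if "T \<in> normal_0_currents K" for c T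
    using \<omega> that by (simp add: charge_space_def)
  have zero: "\<omega> T = 0" if "T \<notin> normal_0_currents K" for T
    using \<omega> that by (simp add: charge_space_def)
  obtain C where C: "charge_bound K \<alpha> \<omega> C" using \<omega> by (auto simp: charge_space_def)
  define f where "f = (\<lambda>x. if x \<in> K then \<omega> (dirac x) else 0)"
  have Lip: "f \<in> Lip_space K \<alpha> \<and> Lip_norm K \<alpha> f \<le> 2 * C" if C: "charge_bound K \<alpha> \<omega> C" for C
  proof -
    have C0: "0 \<le> 2 * C" using C by (simp add: charge_bound_def)
    have 1: "f x = 0" if "x \<notin> K" for x using that by (simp add: f_def)
    have 2: "\<bar>f x\<bar> \<le> 2 * C" if "x \<in> K" for x
      using charge_bound_dirac[OF C \<alpha> that] that C0 by (simp add: f_def)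
    have 3: "\<bar>f x - f y\<bar> \<le> 2 * C * dist x y powr \<alpha>" if "x \<in> K" "y \<in> K" for x y
    proof -
      have "\<omega> (\<lambda>A. dirac x A + (- 1) * dirac y A) = f x - f y"
        unfolding add[OF dirac_normal_0_current[OF that(1)]
            normal_0_currents_cmult[OF dirac_normal_0_current[OF that(2)]]]
          cmult[OF dirac_normal_0_current[OF that(2)]]
        using that by (simp add: f_def)
      then show ?thesis using charge_bound_dirac_diff[OF C \<alpha> that] by simp
    qed
    show ?thesis using Lip_space_intro[OF C0, of K f \<alpha>] 1 2 3 by blast
  qed
  then have f: "f \<in> Lip_space K \<alpha>" using C by blast
  note \<Lambda> = Lambda_map_in_charge_space[OF K \<alpha> f]
  have "Lambda_map K f T = \<omega> T" for T
  proof (cases "T \<in> normal_0_currents K")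
    case True
    \<comment> \<open>The difference is itself a charge, its bound being the sum of the two bounds,
      and it vanishes on Dirac masses.\<close>
    have "\<omega> T - Lambda_map K f T = 0"
    proof (rule charge_eq_0_if_dirac_eq_0[OF K \<alpha> _ _ _ _ True,
          of "\<lambda>T. \<omega> T - Lambda_map K f T" "C + 2 * Lip_norm K \<alpha> f"])
      show "\<omega> (dirac x) - Lambda_map K f (dirac x) = 0" if "x \<in> K" for x
        unfolding Lambda_map_dirac[OF K \<alpha>(1) f that] using that by (simp add: f_def)
      have "\<bar>\<omega> T - Lambda_map K f T\<bar> \<le>
          (C + 2 * Lip_norm K \<alpha> f) * mass T powr (1 - \<alpha>) * flat_norm T powr \<alpha>"
        if "T \<in> normal_0_currents K" for T
      proof -
        have "\<bar>\<omega> T\<bar> \<le> C * mass T powr (1 - \<alpha>) * flat_norm T powr \<alpha>"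
          "\<bar>Lambda_map K f T\<bar> \<le> 2 * Lip_norm K \<alpha> f * mass T powr (1 - \<alpha>) * flat_norm T powr \<alpha>"
          using C charge_bound_Lambda_map[OF K \<alpha> f] that by (auto simp: charge_bound_def)
        then show ?thesis by (simp add: distrib_right)
      qed
      then show "charge_bound K \<alpha> (\<lambda>T. \<omega> T - Lambda_map K f T) (C + 2 * Lip_norm K \<alpha> f)"
        using C Lip_space_bounds(1)[OF K \<alpha>(1) f] by (simp add: charge_bound_def)
    qed (use \<Lambda> in \<open>simp_all add: charge_space_def add cmult right_diff_distrib\<close>)
    then show ?thesis by simp
  next
    case False
    then show ?thesis using zero \<Lambda> by (simp add: charge_space_def)
  qed
  then show ?thesis using that[of f] f Lip by blast
qed

theorem proposition6p1:
  fixes K :: "(real ^ 'd) set" and \<alpha> :: real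
  assumes "compact K" and "0 < \<alpha>" and "\<alpha> \<le> 1"
  shows "normed_space_iso (Lip_space K \<alpha>) (Lip_norm K \<alpha>)
           (charge_space K \<alpha>) (charge_norm K \<alpha>) (Lambda_map K)"
  unfolding normed_space_iso_def
proof (intro conjI ballI allI)
  note bb = Lip_space_bounded_borel[OF assms(1,2)]
  have int: "signed_integral T K f = signed_integral T UNIV f" if "f \<in> Lip_space K \<alpha>"
    "T \<in> normal_0_currents K" for f T
    using fun_cong[OF Lambda_map_eq[OF assms(1,2) that(1)], of T] that(2) by (simp add: Lambda_map_def)
  show "Lambda_map K (\<lambda>i. f i + g i) = (\<lambda>j. Lambda_map K f j + Lambda_map K g j)"
    if fg: "f \<in> Lip_space K \<alpha>" "g \<in> Lip_space K \<alpha>" for f g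
  proof
    fix T
    \<comment> \<open>The sum vanishes off K, which turns the integral over K into one over the
      whole space, where additivity is available.\<close>
    have "(\<lambda>x. indicator K x * (f x + g x)) = (\<lambda>x. f x + g x)"
      using Lip_space_bounds(4)[OF assms(1,2) fg(1)] Lip_space_bounds(4)[OF assms(1,2) fg(2)]
      by (intro ext) (auto simp: indicator_def)
    then have "signed_integral T K (\<lambda>x. f x + g x) = signed_integral T UNIV (\<lambda>x. f x + g x)"
      by (simp add: signed_integral_eq_UNIV[of T K])
    then show "Lambda_map K (\<lambda>i. f i + g i) T = Lambda_map K f T + Lambda_map K g T"
      using signed_integral_add[OF _ bb[OF fg(1)] bb[OF fg(2)], of T] int fg
      by (simp add: Lambda_map_def normal_0_current_signed_measure)
  qed
  show "Lambda_map K (\<lambda>i. c * f i) = (\<lambda>j. c * Lambda_map K f j)"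
    if f: "f \<in> Lip_space K \<alpha>" for c f
  proof
    fix T
    have "(\<lambda>x. indicator K x * (c * f x)) = (\<lambda>x. c * (indicator K x * f x))" by (simp add: mult_ac)
    then show "Lambda_map K (\<lambda>i. c * f i) T = c * Lambda_map K f T"
      by (simp add: Lambda_map_def signed_integral_eq_UNIV[of T K] signed_integral_cmult)
  qed
  have inj: "inj_on (Lambda_map K) (Lip_space K \<alpha>)"
  proof (intro inj_onI ext)
    fix f g x assume fg: "f \<in> Lip_space K \<alpha>" "g \<in> Lip_space K \<alpha>" "Lambda_map K f = Lambda_map K g"
    show "f x = g x"
    proof (cases "x \<in> K")
      case True
      then show ?thesis using fg Lambda_map_dirac[OF assms(1,2)] by metis
    next
      case False
      then show ?thesis using fg(1,2) Lip_space_bounds(4)[OF assms(1,2)] by metis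
    qed
  qed
  moreover have "Lambda_map K ` Lip_space K \<alpha> = charge_space K \<alpha>"
  proof
    show "Lambda_map K ` Lip_space K \<alpha> \<subseteq> charge_space K \<alpha>"
      using Lambda_map_in_charge_space[OF assms] by blast
    show "charge_space K \<alpha> \<subseteq> Lambda_map K ` Lip_space K \<alpha>"
    proof
      fix \<omega> assume "\<omega> \<in> charge_space K \<alpha>"
      then obtain f where "f \<in> Lip_space K \<alpha>" "Lambda_map K f = \<omega>"
        using charge_space_represented[OF assms] by metis
      then show "\<omega> \<in> Lambda_map K ` Lip_space K \<alpha>" by auto
    qed
  qed
  ultimately show "bij_betw (Lambda_map K) (Lip_space K \<alpha>) (charge_space K \<alpha>)"
    by (simp add: bij_betw_def)
  have "charge_norm K \<alpha> (Lambda_map K f) \<le> 2 * Lip_norm K \<alpha> f" if "f \<in> Lip_space K \<alpha>" for f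
    unfolding charge_norm_def
    using charge_bound_Lambda_map[OF assms that]
    by (intro cInf_lower) (auto simp: bdd_below_def charge_bound_def)
  then show "bounded_between (Lip_space K \<alpha>) (Lip_norm K \<alpha>) (charge_norm K \<alpha>) (Lambda_map K)"
    unfolding bounded_between_def by blast
  have "Lip_norm K \<alpha> (inv_into (Lip_space K \<alpha>) (Lambda_map K) \<omega>) \<le> 2 * charge_norm K \<alpha> \<omega>"
    if \<omega>: "\<omega> \<in> charge_space K \<alpha>" for \<omega>
  proof -
    obtain f where f: "f \<in> Lip_space K \<alpha>" "Lambda_map K f = \<omega>"
      "\<And>C. charge_bound K \<alpha> \<omega> C \<Longrightarrow> Lip_norm K \<alpha> f \<le> 2 * C"
      using charge_space_represented[OF assms \<omega>] by metis
    \<comment> \<open>Half of the norm is a lower bound of all admissible constants, hence of their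
      infimum; membership of \<omega> in the charge space makes that set nonempty.\<close>
    have "Lip_norm K \<alpha> f / 2 \<le> charge_norm K \<alpha> \<omega>" unfolding charge_norm_def
    proof (rule cInf_greatest)
      show "{C. charge_bound K \<alpha> \<omega> C} \<noteq> {}" using \<omega> by (auto simp: charge_space_def)
      show "Lip_norm K \<alpha> f / 2 \<le> C" if "C \<in> {C. charge_bound K \<alpha> \<omega> C}" for C
        using f(3)[of C] that by simp
    qed
    moreover have "inv_into (Lip_space K \<alpha>) (Lambda_map K) \<omega> = f"
      using inv_into_f_f[OF inj f(1)] f(2) by simp
    ultimately show ?thesis by simp
  qed
  then show "bounded_between (charge_space K \<alpha>) (charge_norm K \<alpha>) (Lip_norm K \<alpha>)
      (inv_into (Lip_space K \<alpha>) (Lambda_map K))"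
    unfolding bounded_between_def by blast
qed

end
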